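(* Let $K$ be a field, let $S=K[t_1,\ldots,t_s]$, $s\geq 2$, be a polynomial ring with the standard grading, let $\mathbb{X}$ be a finite nonempty subset of the projective space $\mathbb{P}^{s-1}$ over $K$, let $I(\mathbb{X})\subset S$ be its vanishing ideal, and let $\prec$ be a graded monomial order on $S$. Suppose that the initial ideal ${\rm in}_\prec(I(\mathbb{X}))$ is a complete intersection generated by monomials $t^{\alpha_2},\ldots,t^{\alpha_s}$, with $d_i=\deg(t^{\alpha_i})$ and $1\leq d_i\leq d_{i+1}$ for $i\geq 2$. Let $d\geq 1$, and let $0\leq k\leq s-2$ and $\ell$ be integers such that $d=\sum_{i=2}^{k+1}(d_i-1)+\ell$ and $1\leq \ell\leq d_{k+2}-1$. Then $$ |V_\mathbb{X}(f)|\leq \deg(S/I(\mathbb{X}))-(d_{k+2}-\ell)\,d_{k+3}\cdots d_s $$ for every homogeneous polynomial $f\in S_d$ of degree $d$ that does not vanish at all points of $\mathbb{X}$ (with $d_{k+3}\cdots d_s=1$ if $k=s-2$).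
   Context: The vanishing ideal $I(\mathbb{X})$ is the ideal of $S$ generated by the homogeneous polynomials that vanish at all points of $\mathbb{X}$. $V_\mathbb{X}(f)$ is the set of zeros of $f$ in $\mathbb{X}$. An ideal $J\subset S$ is a complete intersection if it can be generated by $r$ elements, where $r$ is the height of $J$. A graded monomial order is one that compares monomials first by total degree. For a graded ideal $J$ of $S$ with $k=\dim(S/J)$ and $H_J(d)=\dim_K(S_d/J_d)$, $\deg(S/J)=(k-1)!\lim_{d\to\infty}H_J(d)/d^{k-1}$ if $k\geq 1$, and $\deg(S/J)=\dim_K(S/J)$ if $k=0$. *)

theory Defs
  imports
    Complex_Main
    "HOL-Library.Poly_Mapping"
    "HOL-Library.Extended_Nat"
    "HOL-Algebra.Algebraic_Closure_Type"
    "HOL-Analysis.Finite_Cartesian_Product"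
begin

section \<open>The polynomial ring\<close>

text \<open>The variables are indexed by a finite type \<open>'n\<close>; a monomial is given by its exponent vector.\<close>

type_synonym 'n monomial = "'n \<Rightarrow>\<^sub>0 nat"
type_synonym ('n, 'k) mpoly = "('n \<Rightarrow>\<^sub>0 nat) \<Rightarrow>\<^sub>0 'k"

abbreviation mpoly_ring :: "('n, 'k::field) mpoly ring"  (\<open>\<S>\<close>)
  where "\<S> \<equiv> ring_of_type_algebra"

definition power_product :: "'n monomial \<Rightarrow> ('n, 'k::field) mpoly"
  where "power_product a = Poly_Mapping.single a 1"

definition mdeg :: "'n::finite monomial \<Rightarrow> nat"
  where "mdeg a = (\<Sum>i\<in>UNIV. Poly_Mapping.lookup a i)"

text \<open>The zero polynomial is homogeneous of every degree.\<close>

definition homogeneous :: "nat \<Rightarrow> ('n::finite, 'k::field) mpoly \<Rightarrow> bool"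
  where "homogeneous d f \<longleftrightarrow> (\<forall>a\<in>Poly_Mapping.keys f. mdeg a = d)"

definition eval_mpoly :: "('n::finite, 'k::field) mpoly \<Rightarrow> 'k ^ 'n \<Rightarrow> 'k"
  where "eval_mpoly f v =
    (\<Sum>a\<in>Poly_Mapping.keys f. Poly_Mapping.lookup f a * (\<Prod>i\<in>UNIV. (v $ i) ^ Poly_Mapping.lookup a i))"

definition scale_mpoly :: "'k \<Rightarrow> ('n, 'k) mpoly \<Rightarrow> ('n, 'k::field) mpoly"
  where "scale_mpoly c f = Poly_Mapping.single 0 c * f"

global_interpretation mpoly: vector_space scale_mpoly
  by unfold_locales
    (simp_all add: scale_mpoly_def algebra_simps single_add mult_single flip: mult.assoc)


section \<open>Projective space and vanishing ideals\<close>

text \<open>A projective point is the set of all its homogeneous coordinate vectors.\<close>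

definition proportional :: "('k::field ^ 'n::finite) rel"
  where "proportional = {(v, w). v \<noteq> 0 \<and> w \<noteq> 0 \<and> (\<exists>c. c \<noteq> 0 \<and> w = c *s v)}"

definition projective_space :: "('k::field ^ 'n::finite) set set"
  where "projective_space = {v. v \<noteq> 0} // proportional"

definition vanishes_at :: "('n::finite, 'k::field) mpoly \<Rightarrow> ('k ^ 'n) set \<Rightarrow> bool"
  where "vanishes_at f P \<longleftrightarrow> (\<forall>v\<in>P. eval_mpoly f v = 0)"

definition zeros_in :: "('k::field ^ 'n::finite) set set \<Rightarrow> ('n, 'k) mpoly \<Rightarrow> ('k ^ 'n) set set"
  where "zeros_in XX f = {P \<in> XX. vanishes_at f P}"

definition vanishing_ideal :: "('k::field ^ 'n::finite) set set \<Rightarrow> ('n, 'k) mpoly set"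
  where "vanishing_ideal XX = Idl\<^bsub>\<S>\<^esub> {f. (\<exists>d. homogeneous d f) \<and> (\<forall>P\<in>XX. vanishes_at f P)}"


section \<open>Monomial orders and initial ideals\<close>

definition monomial_order :: "('n monomial \<Rightarrow> 'n monomial \<Rightarrow> bool) \<Rightarrow> bool"
  where "monomial_order lt \<longleftrightarrow> transp lt \<and> totalp lt \<and> wfp lt \<and>
    (\<forall>a b c. lt a b \<longrightarrow> lt (a + c) (b + c))"

definition graded_monomial_order :: "('n::finite monomial \<Rightarrow> 'n monomial \<Rightarrow> bool) \<Rightarrow> bool"
  where "graded_monomial_order lt \<longleftrightarrow> monomial_order lt \<and>
    (\<forall>a b. mdeg a < mdeg b \<longrightarrow> lt a b)"

definition initial_monomial ::
    "('n monomial \<Rightarrow> 'n monomial \<Rightarrow> bool) \<Rightarrow> ('n, 'k::field) mpoly \<Rightarrow> 'n monomial"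
  where "initial_monomial lt f =
    (THE a. a \<in> Poly_Mapping.keys f \<and> (\<forall>b\<in>Poly_Mapping.keys f. b \<noteq> a \<longrightarrow> lt b a))"

definition initial_ideal ::
    "('n monomial \<Rightarrow> 'n monomial \<Rightarrow> bool) \<Rightarrow> ('n, 'k::field) mpoly set \<Rightarrow> ('n, 'k) mpoly set"
  where "initial_ideal lt J = Idl\<^bsub>\<S>\<^esub> {power_product (initial_monomial lt f) |f. f \<in> J \<and> f \<noteq> 0}"


section \<open>Height, dimension and complete intersections\<close>

definition prime_chain :: "('a, 'b) ring_scheme \<Rightarrow> nat \<Rightarrow> (nat \<Rightarrow> 'a set) \<Rightarrow> bool"
  where "prime_chain R n P \<longleftrightarrow> (\<forall>i\<le>n. primeideal (P i) R) \<and> (\<forall>i<n. P i \<subset> P (Suc i))"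

text \<open>With this convention the zero ring has dimension 0.\<close>

definition krull_dim :: "('a, 'b) ring_scheme \<Rightarrow> enat"
  where "krull_dim R = (SUP n\<in>{n. \<exists>P. prime_chain R n P}. enat n)"

definition prime_height :: "('a, 'b) ring_scheme \<Rightarrow> 'a set \<Rightarrow> enat"
  where "prime_height R p = (SUP n\<in>{n. \<exists>P. prime_chain R n P \<and> P n = p}. enat n)"

definition height :: "('a, 'b) ring_scheme \<Rightarrow> 'a set \<Rightarrow> enat"
  where "height R J = (INF p\<in>{p. primeideal p R \<and> J \<subseteq> p}. prime_height R p)"

definition complete_intersection :: "('a, 'b) ring_scheme \<Rightarrow> 'a set \<Rightarrow> bool"
  where "complete_intersection R J \<longleftrightarrow>
    (\<exists>G. G \<subseteq> carrier R \<and> finite G \<and> J = Idl\<^bsub>R\<^esub> G \<and> enat (card G) = height R J)"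


section \<open>Hilbert function and degree\<close>

text \<open>\<open>B\<close> maps injectively onto a basis of the quotient space \<open>V/W\<close>.\<close>

definition quotient_basis ::
    "('n, 'k::field) mpoly set \<Rightarrow> ('n, 'k) mpoly set \<Rightarrow> ('n, 'k) mpoly set \<Rightarrow> bool"
  where "quotient_basis V W B \<longleftrightarrow> B \<subseteq> V \<and> mpoly.independent B \<and>
    mpoly.span B \<inter> W = {0} \<and> {u + w |u w. u \<in> mpoly.span B \<and> w \<in> W} = V"

text \<open>As for the library's \<^term>\<open>mpoly.dim\<close>, the value is 0 if the dimension is infinite.\<close>

definition quotient_dim :: "('n, 'k::field) mpoly set \<Rightarrow> ('n, 'k) mpoly set \<Rightarrow> nat"
  where "quotient_dim V W = card (SOME B. quotient_basis V W B)"

definition hilbert_function :: "('n::finite, 'k::field) mpoly set \<Rightarrow> nat \<Rightarrow> nat"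
  where "hilbert_function J d =
    quotient_dim {f. homogeneous d f} {f \<in> J. homogeneous d f}"

definition quotient_degree :: "('n::finite, 'k::field) mpoly set \<Rightarrow> real"
  where "quotient_degree J =
    (let k = the_enat (krull_dim (\<S> Quot J)) in
     if k \<ge> 1 then fact (k - 1) * lim (\<lambda>d. real (hilbert_function J d) / real d ^ (k - 1))
     else real (quotient_dim UNIV J))"

end

theory Submission
  imports Defs
begin

unbundle no fps_syntax

text \<open>
  Replace \<open>f\<close> by its normal form \<open>g\<close> modulo \<open>I(X)\<close>: it has the same zeros in \<open>X\<close>, and its initial
  monomial \<open>t\<^sup>a\<close> is standard, that is, not in the initial ideal. If \<open>t\<^sup>a\<^sup>+\<^sup>c\<close> runs through the standard
  multiples of \<open>t\<^sup>a\<close> of a fixed degree, the forms \<open>t\<^sup>c g\<close> are linearly independent modulo \<open>I(X)\<close>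
  because their initial monomials are distinct and standard. They all vanish on \<open>V\<^sub>X(f)\<close>, so in large
  degree there are at most \<open>|X| - |V\<^sub>X(f)|\<close> of them, and \<open>|X|\<close> is the degree of \<open>S/I(X)\<close>.

  For \<open>g = 1\<close> the same argument bounds the number of standard monomials in each degree. Hence any
  two variables support one of the \<open>s - 1\<close> generators of the initial ideal, which forces the
  generators to be powers of distinct variables, except that one of them may involve two variables.
  Counting the standard multiples of \<open>t\<^sup>a\<close> is then explicit: up to the behaviour at the exceptional
  generator there are \<open>\<Prod>(d\<^sub>i - a\<^sub>i)\<close>, and the bound is the minimum of this product under
  \<open>\<Sum>a\<^sub>i \<le> d\<close>.
\<close>

section \<open>Minimizing a product of differences\<close>

text \<open>The minimum of \<open>\<Prod>(d\<^sub>i - x\<^sub>i)\<close> over \<open>0 \<le> x\<^sub>i < d\<^sub>i\<close> with \<open>\<Sum>x\<^sub>i = D\<close>, for sorted \<open>d\<^sub>i\<close>: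
  it is cheapest to spend the budget \<open>D\<close> on the smallest \<open>d\<^sub>i\<close> first.\<close>

fun greedy_prod :: "nat list \<Rightarrow> nat \<Rightarrow> nat" where
  "greedy_prod [] D = 1"
| "greedy_prod (d # ds) D =
    (if d - 1 \<le> D then greedy_prod ds (D - (d - 1)) else (d - D) * prod_list ds)"

text \<open>Induction on the list, split by where the extra budget \<open>r\<close> is spent. If the
  head is already used up, all of \<open>r\<close> goes to the tail. If \<open>r\<close> stays
  within the head, the head factor drops from \<open>e + r\<close> to \<open>e \<ge> 1\<close>, and
  \<open>e + r \<le> Suc r * e\<close>. If \<open>r\<close> finishes the head, the rest
  \<open>l\<close> spills into the next entry, which is at least as large.\<close>

lemma greedy_prod_shift:
  "\<lbrakk>sorted ds; \<forall>x\<in>set ds. Suc r \<le> x\<rbrakk> \<Longrightarrow> greedy_prod ds D \<le> Suc r * greedy_prod ds (D + r)"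
proof (induction ds arbitrary: D)
  case Nil
  then show ?case by simp
next
  case (Cons d ds)
  have IH: "greedy_prod ds E \<le> Suc r * greedy_prod ds (E + r)" for E
    using Cons by simp
  have rd: "Suc r \<le> d" using Cons.prems by simp
  consider "d - 1 \<le> D" | "D < d - 1" "D + r < d - 1" | "D < d - 1" "d - 1 \<le> D + r"
    by linarith
  then show ?case
  proof cases
    case 1
    then show ?thesis using IH[of "D - (d - 1)"] by simp
  next
    case 2
    define e where "e = d - (D + r)"
    have e: "1 \<le> e" "d - D = e + r" "d - (D + r) = e" using 2 by (auto simp: e_def)
    have "r * 1 \<le> r * e" using e(1) by (rule mult_le_mono2)
    then have "d - D \<le> Suc r * (d - (D + r))"
      by (simp add: e(2,3))
    then have "(d - D) * prod_list ds \<le> Suc r * (d - (D + r)) * prod_list ds"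
      by (rule mult_le_mono1)
    moreover have "greedy_prod (d # ds) D = (d - D) * prod_list ds"
      using 2 by simp
    moreover have "greedy_prod (d # ds) (D + r) = (d - (D + r)) * prod_list ds"
      using 2 by simp
    ultimately show ?thesis
      by (simp only: mult.assoc)
  next
    case 3
    define l where "l = D + r - (d - 1)"
    have l: "l < Suc r" "d - D = Suc r - l" using 3 rd by (auto simp: l_def)
    show ?thesis
    proof (cases ds)
      case Nil
      then show ?thesis using 3 l by simp
    next
      case (Cons c cs)
      have dc: "d \<le> c" using Cons.prems Cons by simp
      \<comment> \<open>With every quantity written as a sum of \<open>l\<close>, \<open>p\<close>
        and \<open>q\<close>, truncated subtraction disappears; the two sides of the inequality
        below differ by \<open>l * q\<close>.\<close>
      define p where "p = d - D"
      define q where "q = c - Suc r"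
      have r: "Suc r = l + p" and c: "c = l + p + q" and lc: "l < c - 1" and cl: "c - l = p + q"
        using 3 rd dc by (auto simp: l_def p_def q_def)
      have "p * (l + p + q) \<le> (l + p) * (p + q)"
        by (simp add: algebra_simps)
      then have "p * c \<le> Suc r * (c - l)"
        unfolding r cl unfolding c .
      then have "p * c * prod_list cs \<le> Suc r * (c - l) * prod_list cs"
        by (rule mult_le_mono1)
      moreover have "greedy_prod (d # ds) D = p * (c * prod_list cs)"
        using 3 Cons by (simp add: p_def)
      moreover have "greedy_prod (d # ds) (D + r) = (c - l) * prod_list cs"
        using 3 lc unfolding l_def Cons by simp
      ultimately show ?thesis by (simp only: mult.assoc)
    qed
  qed
qed

text \<open>Exchange argument: no choice \<open>x\<close> for the first coordinate beats the greedy
  one. If the budget can use up the head, choosing \<open>x\<close> hands the unspent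
  \<open>d - 1 - x\<close> to the tail, where by \<open>greedy_prod_shift\<close> it saves at most
  the factor \<open>d - x\<close>. Otherwise the part \<open>y = D - x\<close> moves to the next
  entry \<open>c \<ge> d\<close>.\<close>

lemma greedy_prod_step:
  assumes "sorted (d # ds)" "x < d" "x \<le> D"
  shows "greedy_prod (d # ds) D \<le> (d - x) * greedy_prod ds (D - x)"
proof (cases "d - 1 \<le> D")
  case True
  define r where "r = d - 1 - x"
  have r: "Suc r = d - x" "D - x = (D - (d - 1)) + r" using True assms by (auto simp: r_def)
  have "greedy_prod ds (D - (d - 1)) \<le> Suc r * greedy_prod ds ((D - (d - 1)) + r)"
    using assms r by (intro greedy_prod_shift) auto
  then show ?thesis using True r by simp
next
  case False
  show ?thesis
  proof (cases ds)
    case Nil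
    then show ?thesis using False assms by simp
  next
    case (Cons c cs)
    then have "d \<le> c" using assms by simp
    \<comment> \<open>Written as sums, the two sides of the inequality below differ by
      \<open>y * (x + q)\<close>.\<close>
    define y where "y = D - x"
    define e where "e = d - D"
    define q where "q = c - d"
    have "d - D = e" "d - x = y + e" "c - y = x + e + q" and c: "c = x + y + e + q"
      using False \<open>d \<le> c\<close> assms(2,3) by (auto simp: y_def e_def q_def)
    moreover have "e * (x + y + e + q) \<le> (y + e) * (x + e + q)"
      by (simp add: algebra_simps)
    ultimately have "(d - D) * c \<le> (d - x) * (c - y)"
      by (metis c)
    then have "(d - D) * (c * prod_list cs) \<le> (d - x) * ((c - y) * prod_list cs)"
      unfolding mult.assoc[symmetric] by (rule mult_le_mono1)
    note ineq = this
    have yc: "y < c - 1" using False \<open>d \<le> c\<close> assms(3) by (simp add: y_def)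
    have "greedy_prod (d # ds) D = (d - D) * (c * prod_list cs)"
      using False Cons by simp
    moreover have "greedy_prod ds (D - x) = (c - y) * prod_list cs"
      using yc unfolding y_def Cons by simp
    ultimately show ?thesis using ineq by (simp only:)
  qed
qed

text \<open>Iterates \<open>greedy_prod_step\<close>; budget that \<open>x\<close> leaves unspent is
  passed on to the tail.\<close>

lemma greedy_prod_le:
  assumes "sorted (map d js)" "\<And>i. i \<in> set js \<Longrightarrow> x i < d i" "sum_list (map x js) \<le> D"
  shows "greedy_prod (map d js) D \<le> prod_list (map (\<lambda>i. d i - x i) js)"
  using assms
proof (induction js arbitrary: D)
  case Nil
  then show ?case by simp
next
  case (Cons i js)
  have "greedy_prod (map d js) (D - x i) \<le> prod_list (map (\<lambda>i. d i - x i) js)"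
    using Cons.prems by (intro Cons.IH) auto
  then have "(d i - x i) * greedy_prod (map d js) (D - x i) \<le> prod_list (map (\<lambda>i. d i - x i) (i # js))"
    by simp
  moreover have "greedy_prod (map d (i # js)) D \<le> (d i - x i) * greedy_prod (map d js) (D - x i)"
    using greedy_prod_step[of "d i" "map d js" "x i" D] Cons.prems by (simp del: greedy_prod.simps)
  ultimately show ?case by (rule order_trans[rotated])
qed

lemma greedy_prod_zero: "\<forall>d\<in>set ds. 0 < d \<Longrightarrow> greedy_prod ds 0 = prod_list ds"
proof (induction ds)
  case (Cons d ds)
  then have IH: "greedy_prod ds 0 = prod_list ds" and "d = 1 \<or> \<not> d - 1 \<le> 0" by auto
  then show ?case
  proof (elim disjE)
    assume "d = 1"
    then show ?thesis by (simp add: IH)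
  qed simp
qed simp

text \<open>Evaluates the greedy value at the budget of the theorem: the entries before
  \<open>c\<close> are used up and contribute factors 1, and \<open>l\<close> is left for
  \<open>c\<close>.\<close>

lemma greedy_prod_append:
  assumes "l < c" "\<forall>d\<in>set cs. 0 < d"
  shows "greedy_prod (ds @ c # cs) (sum_list (map (\<lambda>d. d - 1) ds) + l) = (c - l) * prod_list cs"
proof (induction ds)
  case Nil
  show ?case
  proof (cases "c - 1 \<le> l")
    \<comment> \<open>Here \<open>l = c - 1\<close>, so the greedy rule uses up \<open>c\<close> as
      well, and the factor \<open>c - l\<close> is 1.\<close>
    case True
    then have "c = Suc l" using assms by simp
    then show ?thesis using greedy_prod_zero[OF assms(2)] by simp
  next
    case False
    then show ?thesis by simp
  qed
next
  case (Cons d ds)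
  have "sum_list (map (\<lambda>d. d - 1) (d # ds)) + l - (d - 1) = sum_list (map (\<lambda>d. d - 1) ds) + l"
    "d - 1 \<le> sum_list (map (\<lambda>d. d - 1) (d # ds)) + l" by simp_all
  with Cons show ?case by (simp only: append_Cons greedy_prod.simps if_True)
qed

text \<open>Translates the list estimate into the indexing of the theorem. The list of degrees is
  cut at position \<open>k + 2\<close>; \<open>x\<close> will hold exponents of a standard monomial,
  measured against the degrees of the generators.\<close>

lemma prod_diff_ge:
  fixes \<delta> x :: "nat \<Rightarrow> nat"
  assumes "\<And>i. i \<in> {2..<s} \<Longrightarrow> \<delta> i \<le> \<delta> (i + 1)"
    and "\<And>i. i \<in> {2..s} \<Longrightarrow> x i < \<delta> i"
    and "(\<Sum>i=2..s. x i) \<le> (\<Sum>i=2..k+1. (\<delta> i - 1)) + l"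
    and "2 \<le> s" "k \<le> s - 2" "l \<le> \<delta> (k + 2) - 1"
  shows "(\<delta> (k + 2) - l) * (\<Prod>i=k+3..s. \<delta> i) \<le> (\<Prod>i=2..s. \<delta> i - x i)"
proof -
  let ?ds = "map \<delta> [2..<Suc s]"
  have le: "\<delta> i \<le> \<delta> j" if "2 \<le> i" "i \<le> j" "j \<le> s" for i j
    using that(2,1,3)
  proof (induction j rule: dec_induct)
    case (step j)
    then have "\<delta> i \<le> \<delta> j" "\<delta> j \<le> \<delta> (j + 1)" using assms(1)[of j] by auto
    then show ?case by simp
  qed simp
  have sorted: "sorted ?ds"
    unfolding sorted_iff_nth_mono
  proof (intro allI impI)
    fix i j assume "i \<le> j" "j < length ?ds"
    then show "?ds ! i \<le> ?ds ! j" using le[of "2 + i" "2 + j"] by (simp del: upt_Suc)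
  qed
  have split: "[2..<Suc s] = [2..<k+2] @ (k+2) # [k+3..<Suc s]"
    using assms(4,5) upt_add_eq_append[of 2 "k+2" "Suc s - (k+2)"] upt_conv_Cons[of "k+2" "Suc s"]
    by (simp del: upt_Suc add: numeral_3_eq_3)
  have sums: "sum_list (map f [a..<b]) = sum f {a..<b}"
    "prod_list (map f [a..<b]) = prod f {a..<b}" for f :: "nat \<Rightarrow> nat" and a b
    by (simp_all add: interv_sum_list_conv_sum_set_nat prod.distinct_set_conv_list[symmetric] del: upt_Suc)
  have ivl: "{a..<Suc b} = {a..b}" for a b by auto
  have "greedy_prod ?ds ((\<Sum>i=2..k+1. (\<delta> i - 1)) + l) \<le> prod_list (map (\<lambda>i. \<delta> i - x i) [2..<Suc s])"
    using assms(2,3) sorted by (intro greedy_prod_le) (auto simp: sums ivl simp del: upt_Suc)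
  moreover have "greedy_prod ?ds ((\<Sum>i=2..k+1. (\<delta> i - 1)) + l) = (\<delta> (k + 2) - l) * (\<Prod>i=k+3..s. \<delta> i)"
  proof -
    have "greedy_prod (map \<delta> [2..<k+2] @ \<delta> (k+2) # map \<delta> [k+3..<Suc s])
        (sum_list (map (\<lambda>d. d - 1) (map \<delta> [2..<k+2])) + l) = (\<delta> (k + 2) - l) * prod_list (map \<delta> [k+3..<Suc s])"
    proof (rule greedy_prod_append)
      have "k + 2 \<in> {2..s}" using assms(4,5) by simp
      then have "x (k + 2) < \<delta> (k + 2)" by (rule assms(2))
      then show "l < \<delta> (k+2)" using assms(6) by linarith
      have "0 < \<delta> i" if "i \<in> {k+3..s}" for i using assms(2)[of i] that by simp
      then show "\<forall>d\<in>set (map \<delta> [k+3..<Suc s]). 0 < d" by (simp del: upt_Suc)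
    qed
    moreover have "sum_list (map (\<lambda>d. d - 1) (map \<delta> [2..<k+2])) = (\<Sum>i=2..k+1. (\<delta> i - 1))"
      using ivl[of 2 "k+1"] by (simp add: sums comp_def del: upt_Suc)
    moreover have "?ds = map \<delta> [2..<k+2] @ \<delta> (k+2) # map \<delta> [k+3..<Suc s]"
      by (simp only: split map_append list.map)
    ultimately show ?thesis by (simp only: sums ivl)
  qed
  ultimately show ?thesis by (simp only: sums ivl)
qed

section \<open>Supports of the generators\<close>

text \<open>Let \<open>U\<close> collect the variables whose singleton is not a support. It is
  nonempty, since there are fewer supports than variables, and any two of its elements form a
  support. The singletons off \<open>U\<close> and the pairs joining a fixed \<open>q\<close> in
  \<open>U\<close> to the rest of \<open>U\<close> already exhaust all supports, so a pair in
  \<open>U\<close> avoiding \<open>q\<close> is impossible and \<open>U\<close> has at most two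
  elements.\<close>

lemma support_structure:
  fixes S :: "'i \<Rightarrow> 'n::finite set"
  assumes A: "finite A" "Suc (card A) = CARD('n)" "A \<noteq> {}"
    and ne: "\<And>i. i \<in> A \<Longrightarrow> S i \<noteq> {}"
    and pairs: "\<And>p q. p \<noteq> q \<Longrightarrow> \<exists>i\<in>A. S i \<subseteq> {p, q}"
  obtains p q j \<sigma> where "p \<noteq> q" "j \<in> A" "S j \<subseteq> {p, q}"
    "bij_betw \<sigma> (A - {j}) (UNIV - {p, q})" "\<And>i. i \<in> A - {j} \<Longrightarrow> S i = {\<sigma> i}"
proof -
  define T where "T = {x. {x} \<in> S ` A}"
  define U where "U = - T"
  have "U \<noteq> {}"
  proof
    assume "U = {}"
    then have "range (\<lambda>x. {x}) \<subseteq> S ` A" by (auto simp: U_def T_def)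
    then have "card (range (\<lambda>x::'n. {x})) \<le> card (S ` A)" using A by (intro card_mono) auto
    also have "\<dots> \<le> card A" using A by (intro card_image_le)
    finally show False using A(2) by (simp add: card_image)
  qed
  then obtain q where q: "q \<in> U" by auto
  have pairU: "{x, y} \<in> S ` A" if "x \<in> U" "y \<in> U" "x \<noteq> y" for x y
  proof -
    obtain i where i: "i \<in> A" "S i \<subseteq> {x, y}" using pairs \<open>x \<noteq> y\<close> by blast
    have "S i \<noteq> {x}" "S i \<noteq> {y}" using i(1) that by (auto simp: U_def T_def)
    then have "S i = {x, y}" using ne[OF i(1)] i(2) by blast
    then show ?thesis using i(1) by blast
  qed
  \<comment> \<open>These supports already number \<open>card A\<close>, so there are no others.\<close>
  define G where "G = (\<lambda>x. {x}) ` T \<union> (\<lambda>y. {q, y}) ` (U - {q})"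
  have GS: "G \<subseteq> S ` A" using pairU[OF q] by (auto simp: G_def T_def)
  have "card G = card ((\<lambda>x. {x}) ` T) + card ((\<lambda>y. {q, y}) ` (U - {q}))"
    unfolding G_def by (rule card_Un_disjoint) (simp, simp, blast)
  also have "\<dots> = card T + card (U - {q})"
    by (auto intro!: arg_cong2[of _ _ _ _ "(+)"] card_image inj_onI)
  also have "\<dots> = card A"
  proof -
    have "card T + card U = CARD('n)"
      using card_Un_disjoint[of T U] by (simp add: U_def)
    moreover have "card U = Suc (card (U - {q}))"
      using q by (intro card.remove) auto
    ultimately show ?thesis using A(2) by simp
  qed
  finally have cG: "card G = card A" .
  have "card (S ` A) \<le> card A" using A by (intro card_image_le)
  then have G: "G = S ` A" using cG GS A by (intro card_seteq) auto
  then have inj: "inj_on S A" using cG A by (intro eq_card_imp_inj_on) auto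
  have U2: "y = z" if "y \<in> U - {q}" "z \<in> U - {q}" for y z
  proof (rule ccontr)
    assume "y \<noteq> z"
    then have "{y, z} \<in> G" using pairU[of y z] that G by auto
    then have "(\<exists>x. {y, z} = {x}) \<or> (\<exists>w. {y, z} = {q, w})" unfolding G_def by blast
    then show False using that \<open>y \<noteq> z\<close> by blast
  qed
  have "\<exists>p. p \<noteq> q \<and> U \<subseteq> {p, q}"
  proof (cases "U = {q}")
    case True
    have "\<exists>p. p \<noteq> q"
    proof (rule ccontr)
      assume "\<not> ?thesis"
      then have "(UNIV :: 'n set) = {q}" by auto
      then have "CARD('n) = 1" by (metis card_1_singleton_iff One_nat_def)
      then show False using A by auto
    qed
    then show ?thesis using True by auto
  next
    case False
    then show ?thesis using U2 q by blast
  qed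
  then obtain p where p: "p \<noteq> q" "U \<subseteq> {p, q}" by auto
  \<comment> \<open>If \<open>U = {p, q}\<close>, the pair itself is a support. If
    \<open>U = {q}\<close>, the singleton of the arbitrary \<open>p\<close> is set aside instead.
    Either way exactly the singletons off \<open>{p, q}\<close> remain.\<close>
  define P where "P = (if p \<in> U then {q, p} else {p})"
  have "P \<in> G" using p by (auto simp: P_def G_def U_def)
  then obtain j where j: "j \<in> A" "S j = P" using G by auto
  have "S ` (A - {j}) = G - {P}"
    using inj j G inj_on_image_set_diff[of S A A "{j}"] by auto
  also have "\<dots> = (\<lambda>x. {x}) ` (UNIV - {p, q})"
    using p q unfolding P_def G_def U_def by (auto simp: doubleton_eq_iff)
  finally have im: "S ` (A - {j}) = (\<lambda>x. {x}) ` (UNIV - {p, q})" .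
  define \<sigma> where "\<sigma> i = the_elem (S i)" for i
  have \<sigma>: "S i = {\<sigma> i}" if "i \<in> A - {j}" for i
  proof -
    have "S i \<in> (\<lambda>x. {x}) ` (UNIV - {p, q})" using im that by blast
    then obtain x where "S i = {x}" by blast
    then show ?thesis by (simp add: \<sigma>_def)
  qed
  have "bij_betw \<sigma> (A - {j}) (UNIV - {p, q})"
  proof (rule bij_betw_imageI)
    show "inj_on \<sigma> (A - {j})"
      using inj \<sigma> by (metis (no_types, lifting) DiffD1 inj_on_def)
    have "\<sigma> ` (A - {j}) = the_elem ` S ` (A - {j})" by (simp add: \<sigma>_def image_image)
    also have "\<dots> = UNIV - {p, q}" by (simp add: im image_image)
    finally show "\<sigma> ` (A - {j}) = UNIV - {p, q}" .
  qed
  then show ?thesis using that[of p q j \<sigma>] p j \<sigma> by (auto simp: P_def)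
qed

section \<open>Ideals of type-class rings\<close>

lemma ring_of_type_algebra_simps [simp]:
  "carrier ring_of_type_algebra = (UNIV :: 'a::comm_ring_1 set)"
  "monoid.mult ring_of_type_algebra = ((*) :: 'a \<Rightarrow> 'a \<Rightarrow> 'a)"
  "ring.add ring_of_type_algebra = ((+) :: 'a \<Rightarrow> 'a \<Rightarrow> 'a)"
  "monoid.one ring_of_type_algebra = (1 :: 'a)"
  "ring.zero ring_of_type_algebra = (0 :: 'a)"
  by (simp_all add: ring_of_type_algebra_def fun_eq_iff)

lemma a_inv_ring_of_type_algebra [simp]:
  "a_inv ring_of_type_algebra x = - (x :: 'a::comm_ring_1)"
proof -
  interpret cring "ring_of_type_algebra :: 'a ring"
    by (rule cring_from_type_algebra)
  show ?thesis by (rule minus_equality) auto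
qed

lemma ideal_type_ringI:
  fixes J :: "'a::comm_ring_1 set"
  assumes "0 \<in> J" "\<And>x y. x \<in> J \<Longrightarrow> y \<in> J \<Longrightarrow> x + y \<in> J" "\<And>r x. x \<in> J \<Longrightarrow> r * x \<in> J"
  shows "ideal J ring_of_type_algebra"
proof -
  interpret cring "ring_of_type_algebra :: 'a ring"
    by (rule cring_from_type_algebra)
  show ?thesis
  proof (rule idealI)
    show "subgroup J (add_monoid ring_of_type_algebra)"
      using assms(1,2) assms(3)[of _ "- 1"]
      by (intro add.subgroupI) (auto simp: a_inv_def[symmetric])
    show "ring (ring_of_type_algebra :: 'a ring)" by (rule ring_axioms)
  qed (use assms(3) in \<open>auto simp: mult.commute\<close>)
qed

lemma ideal_type_ringD:
  fixes J :: "'a::comm_ring_1 set"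
  assumes "ideal J ring_of_type_algebra"
  shows "0 \<in> J" "x \<in> J \<Longrightarrow> y \<in> J \<Longrightarrow> x + y \<in> J" "x \<in> J \<Longrightarrow> r * x \<in> J"
    "x \<in> J \<Longrightarrow> y \<in> J \<Longrightarrow> x - y \<in> J"
    "\<lbrakk>\<And>i. i \<in> A \<Longrightarrow> g i \<in> J\<rbrakk> \<Longrightarrow> sum g A \<in> J"
proof -
  interpret ideal J "ring_of_type_algebra :: 'a ring" by (rule assms)
  show 0: "0 \<in> J" using additive_subgroup.zero_closed[OF is_additive_subgroup] by simp
  show add: "x \<in> J \<Longrightarrow> y \<in> J \<Longrightarrow> x + y \<in> J" for x y using additive_subgroup.a_closed[OF is_additive_subgroup, of x y] by simp
  show mult: "x \<in> J \<Longrightarrow> r * x \<in> J" for x r using I_l_closed[of x r] by simp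
  show "x \<in> J \<Longrightarrow> y \<in> J \<Longrightarrow> x - y \<in> J" using add[of x "- y"] mult[of y "- 1"] by simp
  show "\<lbrakk>\<And>i. i \<in> A \<Longrightarrow> g i \<in> J\<rbrakk> \<Longrightarrow> sum g A \<in> J"
    by (induction A rule: infinite_finite_induct) (auto intro: 0 add)
qed

lemma genideal_type_ring:
  fixes G :: "'a::comm_ring_1 set"
  shows "ideal (Idl\<^bsub>ring_of_type_algebra\<^esub> G) ring_of_type_algebra"
    and "G \<subseteq> Idl\<^bsub>ring_of_type_algebra\<^esub> G"
    and "ideal J ring_of_type_algebra \<Longrightarrow> G \<subseteq> J \<Longrightarrow> Idl\<^bsub>ring_of_type_algebra\<^esub> G \<subseteq> J"
proof -
  interpret cring "ring_of_type_algebra :: 'a ring"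
    by (rule cring_from_type_algebra)
  show "ideal (Idl\<^bsub>ring_of_type_algebra\<^esub> G) ring_of_type_algebra"
    by (rule genideal_ideal) simp
  show "G \<subseteq> Idl\<^bsub>ring_of_type_algebra\<^esub> G"
    by (rule genideal_self) simp
  show "ideal J ring_of_type_algebra \<Longrightarrow> G \<subseteq> J \<Longrightarrow> Idl\<^bsub>ring_of_type_algebra\<^esub> G \<subseteq> J"
    by (rule genideal_minimal)
qed

section \<open>Evaluation along a line through the origin\<close>

lemma mdeg_add: "mdeg (a + b) = mdeg a + mdeg b"
  by (simp add: mdeg_def lookup_add sum.distrib)

lemma mdeg_zero [simp]: "mdeg 0 = 0"
  by (simp add: mdeg_def)

lemma poly_mapping_sum_single: "f = (\<Sum>a\<in>Poly_Mapping.keys f. Poly_Mapping.single a (Poly_Mapping.lookup f a))"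
  by (rule poly_mapping_eqI) (auto simp: lookup_sum lookup_single when_def in_keys_iff)

text \<open>The substitution \<open>t\<^sub>i \<mapsto> v\<^sub>i x\<close>: the coefficient of \<open>x\<^sup>n\<close> is the value at \<open>v\<close> of the
  homogeneous component of degree \<open>n\<close>, so its kernel is the homogeneous vanishing ideal of one point.\<close>

definition line_eval :: "'k::field ^ 'n::finite \<Rightarrow> ('n, 'k) mpoly \<Rightarrow> 'k poly"
  where "line_eval v f = (\<Sum>a\<in>Poly_Mapping.keys f.
    monom (Poly_Mapping.lookup f a * (\<Prod>i\<in>UNIV. (v $ i) ^ Poly_Mapping.lookup a i)) (mdeg a))"

lemma line_eval_superset:
  assumes "finite A" "Poly_Mapping.keys f \<subseteq> A"
  shows "line_eval v f = (\<Sum>a\<in>A.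
    monom (Poly_Mapping.lookup f a * (\<Prod>i\<in>UNIV. (v $ i) ^ Poly_Mapping.lookup a i)) (mdeg a))"
  unfolding line_eval_def using assms by (intro sum.mono_neutral_left) (auto simp: in_keys_iff)

lemma line_eval_zero [simp]: "line_eval v 0 = 0"
  by (simp add: line_eval_def)

lemma line_eval_add: "line_eval v (f + g) = line_eval v f + line_eval v g"
proof -
  let ?A = "Poly_Mapping.keys f \<union> Poly_Mapping.keys g"
  show ?thesis
    using line_eval_superset[of ?A "f + g" v] line_eval_superset[of ?A f v] line_eval_superset[of ?A g v]
      Poly_Mapping.keys_add[of f g]
    by (simp add: lookup_add distrib_right add_monom[symmetric] sum.distrib)
qed

lemma line_eval_sum: "line_eval v (sum f A) = (\<Sum>i\<in>A. line_eval v (f i))"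
  by (induction A rule: infinite_finite_induct) (auto simp: line_eval_add)

lemma line_eval_single:
  "line_eval v (Poly_Mapping.single a c) = monom (c * (\<Prod>i\<in>UNIV. (v $ i) ^ Poly_Mapping.lookup a i)) (mdeg a)"
  by (subst line_eval_superset[of "{a}"]) auto

lemma line_eval_mult: "line_eval v (f * g) = line_eval v f * line_eval v g"
proof -
  have single: "line_eval v (Poly_Mapping.single a c * Poly_Mapping.single b e) =
      line_eval v (Poly_Mapping.single a c) * line_eval v (Poly_Mapping.single b e)" for a b c e
    by (simp add: mult_single line_eval_single mult_monom mdeg_add lookup_add power_add prod.distrib mult_ac)
  define F where "F a = Poly_Mapping.single a (Poly_Mapping.lookup f a)" for a
  define G where "G a = Poly_Mapping.single a (Poly_Mapping.lookup g a)" for a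
  have "f = sum F (Poly_Mapping.keys f)" "g = sum G (Poly_Mapping.keys g)"
    unfolding F_def G_def by (rule poly_mapping_sum_single)+
  moreover have "line_eval v (sum F A * sum G B) = line_eval v (sum F A) * line_eval v (sum G B)" for A B
    by (simp add: sum_product line_eval_sum single F_def G_def)
  ultimately show ?thesis by metis
qed

lemma line_eval_one [simp]: "line_eval v 1 = 1"
  unfolding single_one[symmetric] line_eval_single by simp

lemma line_eval_diff: "line_eval v (f - g) = line_eval v f - line_eval v g"
  using line_eval_add[of v "f - g" g] by simp

lemma line_eval_scale: "line_eval v (scale_mpoly c f) = smult c (line_eval v f)"
  by (simp add: scale_mpoly_def line_eval_mult line_eval_single monom_0)

lemma line_eval_prod: "line_eval v (prod f A) = (\<Prod>i\<in>A. line_eval v (f i))"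
  by (induction A rule: infinite_finite_induct) (auto simp: line_eval_mult)

lemma eval_mpoly_eq: "eval_mpoly f v = poly (line_eval v f) 1"
  by (simp add: eval_mpoly_def line_eval_def poly_sum poly_monom)

lemma eval_mpoly_simps:
  "eval_mpoly 0 v = 0" "eval_mpoly 1 v = 1"
  "eval_mpoly (f + g) v = eval_mpoly f v + eval_mpoly g v"
  "eval_mpoly (f - g) v = eval_mpoly f v - eval_mpoly g v"
  "eval_mpoly (f * g) v = eval_mpoly f v * eval_mpoly g v"
  "eval_mpoly (scale_mpoly c f) v = c * eval_mpoly f v"
  "eval_mpoly (sum h A) v = (\<Sum>i\<in>A. eval_mpoly (h i) v)"
  "eval_mpoly (prod h A) v = (\<Prod>i\<in>A. eval_mpoly (h i) v)"
  by (simp_all add: eval_mpoly_eq line_eval_add line_eval_diff line_eval_mult line_eval_scale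
      line_eval_sum line_eval_prod poly_sum poly_prod)

section \<open>Homogeneous polynomials and homogeneous components\<close>

lemma line_eval_homogeneous:
  "homogeneous d f \<Longrightarrow> line_eval v f = monom (eval_mpoly f v) d"
  by (simp add: homogeneous_def line_eval_def eval_mpoly_def monom_sum)

lemma line_eval_eq_0_iff:
  "homogeneous d f \<Longrightarrow> line_eval v f = 0 \<longleftrightarrow> eval_mpoly f v = 0"
  by (simp add: line_eval_homogeneous monom_eq_0_iff)

lemma eval_mpoly_scale_arg:
  "homogeneous d f \<Longrightarrow> eval_mpoly f (c *s v) = c ^ d * eval_mpoly f v"
  by (simp add: eval_mpoly_def homogeneous_def power_mult_distrib prod.distrib sum_distrib_left
      power_sum[symmetric] mdeg_def[symmetric] mult_ac)

lemma homogeneous_zero [simp]: "homogeneous d 0"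
  by (simp add: homogeneous_def)

lemma homogeneous_one [simp]: "homogeneous 0 1"
  by (simp add: homogeneous_def)

lemma homogeneous_add: "homogeneous d f \<Longrightarrow> homogeneous d g \<Longrightarrow> homogeneous d (f + g)"
  using Poly_Mapping.keys_add[of f g] by (auto simp: homogeneous_def)

lemma homogeneous_single: "mdeg a = d \<Longrightarrow> homogeneous d (Poly_Mapping.single a c)"
  by (auto simp: homogeneous_def)

lemma homogeneous_mult: "homogeneous d f \<Longrightarrow> homogeneous e g \<Longrightarrow> homogeneous (d + e) (f * g)"
  unfolding homogeneous_def using keys_mult[of f g] by (auto simp: mdeg_add)

lemma homogeneous_scale: "homogeneous d f \<Longrightarrow> homogeneous d (scale_mpoly c f)"
  unfolding scale_mpoly_def using homogeneous_mult[of 0 "Poly_Mapping.single 0 c" d f]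
  by (simp add: homogeneous_single)

lemma homogeneous_diff: "homogeneous d f \<Longrightarrow> homogeneous d g \<Longrightarrow> homogeneous d (f - g)"
  using homogeneous_add[of d f "scale_mpoly (- 1) g"] homogeneous_scale[of d g "- 1"]
  by (simp add: scale_mpoly_def single_uminus)

lemma homogeneous_sum: "(\<And>i. i \<in> A \<Longrightarrow> homogeneous d (h i)) \<Longrightarrow> homogeneous d (sum h A)"
  by (induction A rule: infinite_finite_induct) (auto intro: homogeneous_add)

lemma homogeneous_prod: "(\<And>i. i \<in> A \<Longrightarrow> homogeneous (e i) (h i)) \<Longrightarrow> homogeneous (sum e A) (prod h A)"
  by (induction A rule: infinite_finite_induct) (auto intro: homogeneous_mult)

definition hom_component :: "nat \<Rightarrow> ('n::finite, 'k::field) mpoly \<Rightarrow> ('n, 'k) mpoly"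
  where "hom_component n f =
    (\<Sum>a | a \<in> Poly_Mapping.keys f \<and> mdeg a = n. Poly_Mapping.single a (Poly_Mapping.lookup f a))"

lemma lookup_hom_component:
  "Poly_Mapping.lookup (hom_component n f) a = (if mdeg a = n then Poly_Mapping.lookup f a else 0)"
  unfolding hom_component_def
  by (auto simp: lookup_sum lookup_single when_def in_keys_iff)

lemma homogeneous_hom_component: "homogeneous n (hom_component n f)"
  by (auto simp: homogeneous_def in_keys_iff lookup_hom_component split: if_splits)

lemma sum_hom_component: "f = (\<Sum>n\<in>mdeg ` Poly_Mapping.keys f. hom_component n f)"
  by (rule poly_mapping_eqI) (auto simp: lookup_sum lookup_hom_component in_keys_iff)

lemma eval_hom_component: "eval_mpoly (hom_component n f) v = coeff (line_eval v f) n"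
proof -
  have "coeff (line_eval v f) n = (\<Sum>a\<in>Poly_Mapping.keys f. if mdeg a = n then
      Poly_Mapping.lookup f a * (\<Prod>i\<in>UNIV. (v $ i) ^ Poly_Mapping.lookup a i) else 0)"
    by (simp add: line_eval_def coeff_sum)
  also have "\<dots> = eval_mpoly (hom_component n f) v"
    unfolding eval_mpoly_def
    by (intro sum.mono_neutral_cong_right) (auto simp: in_keys_iff lookup_hom_component split: if_splits)
  finally show ?thesis by simp
qed

text \<open>The right side is an ideal containing the generators. Conversely, the coefficients of
  \<open>line_eval v f\<close> are the values of the homogeneous components of \<open>f\<close>, so
  these components are generators. Using \<open>line_eval\<close> rather than values matters over
  finite fields, where a polynomial can vanish at all representatives of a point while its
  components do not.\<close>

lemma vanishing_ideal_eq: "vanishing_ideal XX = {f. \<forall>P\<in>XX. \<forall>v\<in>P. line_eval v f = 0}" (is "_ = ?J")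
proof
  let ?G = "{f. (\<exists>d. homogeneous d f) \<and> (\<forall>P\<in>XX. vanishes_at f P)}"
  have "ideal ?J \<S>"
    by (rule ideal_type_ringI) (auto simp: line_eval_add line_eval_mult)
  moreover have "?G \<subseteq> ?J"
    by (auto simp: vanishes_at_def line_eval_eq_0_iff)
  ultimately show "vanishing_ideal XX \<subseteq> ?J"
    unfolding vanishing_ideal_def by (rule genideal_type_ring(3))
  show "?J \<subseteq> vanishing_ideal XX"
  proof
    fix f assume "f \<in> ?J"
    then have "hom_component n f \<in> ?G" for n
      using homogeneous_hom_component[of n f] by (auto simp: vanishes_at_def eval_hom_component)
    then have "hom_component n f \<in> vanishing_ideal XX" for n
      unfolding vanishing_ideal_def using genideal_type_ring(2) by blast
    then show "f \<in> vanishing_ideal XX"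
      by (subst sum_hom_component[of f])
        (auto intro: ideal_type_ringD(5) simp: vanishing_ideal_def genideal_type_ring(1))
  qed
qed

section \<open>Forms modulo the vanishing ideal of a point set\<close>

lemma variable_props:
  fixes i :: "'n::finite" and v :: "'k::field ^ 'n"
  defines "x \<equiv> Poly_Mapping.single (Poly_Mapping.single i 1) 1"
  shows "homogeneous 1 x" "eval_mpoly x v = v $ i"
proof -
  have d: "mdeg (Poly_Mapping.single i 1) = 1"
    by (simp add: mdeg_def lookup_single when_def)
  show "homogeneous 1 x" unfolding x_def by (rule homogeneous_single) (rule d)
  have "(\<Prod>j\<in>UNIV. (v $ j) ^ Poly_Mapping.lookup (Poly_Mapping.single i 1) j) = v $ i"
    by (subst prod.remove[of _ i]) (auto simp: lookup_single when_def)
  then show "eval_mpoly x v = v $ i"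
    unfolding x_def eval_mpoly_eq line_eval_single by (simp add: poly_monom)
qed

text \<open>A projective point set encoded by one nonzero representative per point, so that forms
  take definite values and interpolation is linear algebra over functions on
  \<open>R\<close>.\<close>

locale point_set =
  fixes R :: "('k::field ^ 'n::finite) set"
  assumes finite: "finite R"
    and nonzero: "v \<in> R \<Longrightarrow> v \<noteq> 0"
    and not_proportional: "v \<in> R \<Longrightarrow> w \<in> R \<Longrightarrow> w = c *s v \<Longrightarrow> w = v"
begin

definition vanish :: "('n, 'k) mpoly set"
  where "vanish = {f. \<forall>v\<in>R. line_eval v f = 0}"

lemma homogeneous_vanish_iff: "homogeneous d f \<Longrightarrow> f \<in> vanish \<longleftrightarrow> (\<forall>v\<in>R. eval_mpoly f v = 0)"
  by (simp add: vanish_def line_eval_eq_0_iff)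

lemma ideal_vanish: "ideal vanish \<S>"
  by (rule ideal_type_ringI) (auto simp: vanish_def line_eval_add line_eval_mult)

lemma hom_component_vanish: "f \<in> vanish \<Longrightarrow> hom_component n f \<in> vanish"
  using homogeneous_vanish_iff[OF homogeneous_hom_component] by (auto simp: eval_hom_component vanish_def)

text \<open>Non-proportional vectors have a nonzero 2 by 2 minor; expanding it along
  \<open>v\<close> gives the linear form \<open>w_j t_i - w_i t_j\<close>.\<close>

lemma linear_separator:
  assumes "v \<in> R" "w \<in> R" "w \<noteq> v"
  shows "\<exists>L. homogeneous 1 L \<and> eval_mpoly L v \<noteq> 0 \<and> eval_mpoly L w = 0"
proof -
  obtain j where j: "w $ j \<noteq> 0" using nonzero[OF assms(2)] by (auto simp: vec_eq_iff)
  have "\<exists>i. v $ i * w $ j \<noteq> v $ j * w $ i"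
  proof (rule ccontr)
    assume "\<not> ?thesis"
    then have eq: "v $ i * w $ j = v $ j * w $ i" for i by blast
    have "v = (v $ j / w $ j) *s w"
      using j by (simp add: vec_eq_iff divide_simps eq)
    then show False using not_proportional[OF assms(2,1)] assms(3) by metis
  qed
  then obtain i where i: "v $ i * w $ j \<noteq> v $ j * w $ i" by auto
  define t where "t i = (Poly_Mapping.single (Poly_Mapping.single i 1) 1 :: ('n, 'k) mpoly)" for i
  define L where "L = scale_mpoly (w $ j) (t i) - scale_mpoly (w $ i) (t j)"
  have "homogeneous 1 L"
    unfolding L_def t_def by (intro homogeneous_diff homogeneous_scale variable_props(1))
  moreover have "eval_mpoly L u = w $ j * u $ i - w $ i * u $ j" for u
    by (simp only: L_def t_def eval_mpoly_simps variable_props(2))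
  ultimately show ?thesis
    using i by (intro exI[of _ L]) (auto simp: mult.commute)
qed

text \<open>Multiply the linear forms separating \<open>v\<close> from each other point, pad with
  powers of a variable that is nonzero at \<open>v\<close> to reach degree \<open>e\<close>, and
  normalize the value at \<open>v\<close>.\<close>

lemma separator:
  assumes "v \<in> R" "card R \<le> e"
  shows "\<exists>F. homogeneous e F \<and> eval_mpoly F v = 1 \<and> (\<forall>w\<in>R - {v}. eval_mpoly F w = 0)"
proof -
  have "\<forall>w\<in>R - {v}. \<exists>L. homogeneous 1 L \<and> eval_mpoly L v \<noteq> 0 \<and> eval_mpoly L w = 0"
    using linear_separator assms(1) by blast
  then obtain L where L: "\<And>w. w \<in> R - {v} \<Longrightarrow> homogeneous 1 (L w) \<and> eval_mpoly (L w) v \<noteq> 0 \<and> eval_mpoly (L w) w = 0"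
    by metis
  obtain i where i: "v $ i \<noteq> 0" using nonzero[OF assms(1)] by (auto simp: vec_eq_iff)
  define t where "t = (Poly_Mapping.single (Poly_Mapping.single i 1) 1 :: ('n, 'k) mpoly)"
  define m where "m = e - card (R - {v})"
  define F where "F = prod L (R - {v}) * (\<Prod>_\<in>{..<m}. t)"
  have "homogeneous (sum (\<lambda>_. 1) (R - {v}) + sum (\<lambda>_. 1) {..<m}) F"
    unfolding F_def using L by (intro homogeneous_mult homogeneous_prod) (auto simp: t_def variable_props(1)[simplified])
  moreover have "card (R - {v}) \<le> e" using assms finite by (meson card_Diff1_le le_trans)
  ultimately have F: "homogeneous e F" by (simp add: m_def)
  have ev: "eval_mpoly F u = (\<Prod>w\<in>R - {v}. eval_mpoly (L w) u) * (u $ i) ^ m" for u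
    unfolding F_def eval_mpoly_simps t_def variable_props(2) by simp
  have "eval_mpoly F v \<noteq> 0" using ev[of v] L i finite by simp
  moreover have "eval_mpoly F w = 0" if "w \<in> R - {v}" for w
    using ev[of w] L[OF that] that finite by (auto simp: prod_zero_iff)
  ultimately show ?thesis
    using F by (intro exI[of _ "scale_mpoly (1 / eval_mpoly F v) F"])
      (auto simp: homogeneous_scale eval_mpoly_simps)
qed

section \<open>Lagrange interpolation and the Hilbert function\<close>

definition sep :: "nat \<Rightarrow> 'k ^ 'n \<Rightarrow> ('n, 'k) mpoly"
  where "sep e v = (SOME F. homogeneous e F \<and> eval_mpoly F v = 1 \<and> (\<forall>w\<in>R - {v}. eval_mpoly F w = 0))"

text \<open>For \<open>card R \<le> e\<close>, on forms of degree \<open>e\<close> this is the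
  projection onto the span of the separators along the forms vanishing on \<open>R\<close>.\<close>

definition interpolate :: "nat \<Rightarrow> ('n, 'k) mpoly \<Rightarrow> ('n, 'k) mpoly"
  where "interpolate e f = (\<Sum>v\<in>R. scale_mpoly (eval_mpoly f v) (sep e v))"

context
  fixes e assumes e: "card R \<le> e"
begin

lemma sep:
  assumes "v \<in> R"
  shows "homogeneous e (sep e v)" "w \<in> R \<Longrightarrow> eval_mpoly (sep e v) w = (if w = v then 1 else 0)"
  using someI_ex[OF separator[OF assms e]] unfolding sep_def[symmetric] by auto

lemma homogeneous_interpolate: "homogeneous e (interpolate e f)"
  unfolding interpolate_def by (intro homogeneous_sum homogeneous_scale sep)

lemma eval_interpolate:
  assumes "w \<in> R"
  shows "eval_mpoly (interpolate e f) w = eval_mpoly f w"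
proof -
  have "eval_mpoly (interpolate e f) w = (\<Sum>v\<in>R. if w = v then eval_mpoly f v else 0)"
    unfolding interpolate_def eval_mpoly_simps by (intro sum.cong) (auto simp: sep assms)
  then show ?thesis using finite assms by simp
qed

lemma linear_interpolate: "Vector_Spaces.linear scale_mpoly scale_mpoly (interpolate e)"
  unfolding Vector_Spaces.linear_iff
  by (auto simp: mpoly.vector_space_axioms interpolate_def eval_mpoly_simps mpoly.scale_left_distrib
      sum.distrib mpoly.scale_sum_right)

lemma interpolate_sep: "v \<in> R \<Longrightarrow> interpolate e (sep e v) = sep e v"
proof -
  assume v: "v \<in> R"
  have "interpolate e (sep e v) = (\<Sum>w\<in>R. if w = v then sep e v else 0)"
    unfolding interpolate_def using v by (intro sum.cong) (auto simp: sep)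
  then show ?thesis using finite v by simp
qed

text \<open>A form in the span of \<open>B\<close> with zero interpolant lies in
  \<open>vanish\<close>, hence is 0; so interpolation keeps \<open>B\<close> independent. Since
  \<open>B\<close> vanishes off \<open>Z\<close>, its image lies in the span of the separators of
  \<open>Z\<close>.\<close>

lemma card_le_of_independent_mod:
  assumes B: "\<And>b. b \<in> B \<Longrightarrow> homogeneous e b" "mpoly.independent B"
    and W: "mpoly.span B \<inter> vanish \<subseteq> {0}"
    and Z: "Z \<subseteq> R" "\<And>b v. b \<in> B \<Longrightarrow> v \<in> R - Z \<Longrightarrow> eval_mpoly b v = 0"
  shows "finite B \<and> card B \<le> card Z"
proof -
  interpret vector_space_pair scale_mpoly scale_mpoly by unfold_locales
  have sub: "mpoly.subspace {f. homogeneous e f}"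
    unfolding mpoly.subspace_def by (auto intro: homogeneous_add homogeneous_scale)
  have homB: "homogeneous e f" if "f \<in> mpoly.span B" for f
    using mpoly.span_minimal[OF _ sub, of B] B(1) that by auto
  have inj: "inj_on (interpolate e) (mpoly.span B)"
    unfolding linear_inj_on_iff_eq_0[OF linear_interpolate mpoly.subspace_span]
  proof (intro ballI impI)
    fix f assume f: "f \<in> mpoly.span B" "interpolate e f = 0"
    then have "eval_mpoly f v = 0" if "v \<in> R" for v
      using eval_interpolate[OF that, of f] by (simp add: eval_mpoly_simps)
    then have "f \<in> vanish" using homogeneous_vanish_iff[OF homB[OF f(1)]] by blast
    then show "f = 0" using W f(1) by blast
  qed
  have ind: "mpoly.independent (interpolate e ` B)"
    using linear_independent_injective_image[OF linear_interpolate B(2) inj] .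
  have "interpolate e b \<in> mpoly.span (sep e ` Z)" if "b \<in> B" for b
  proof -
    have "interpolate e b = (\<Sum>v\<in>Z. scale_mpoly (eval_mpoly b v) (sep e v))"
      unfolding interpolate_def using finite Z that
      by (intro sum.mono_neutral_right) (auto simp: mpoly.scale_zero_left)
    then show ?thesis
      by (simp only:) (intro mpoly.span_sum mpoly.span_scale mpoly.span_base imageI)
  qed
  then have "interpolate e ` B \<subseteq> mpoly.span (sep e ` Z)" by blast
  moreover have finZ: "finite Z" using finite Z(1) finite_subset by blast
  ultimately have *: "finite (interpolate e ` B)" "card (interpolate e ` B) \<le> card (sep e ` Z)"
    using mpoly.independent_span_bound[OF finite_imageI ind] by auto
  have injB: "inj_on (interpolate e) B" using inj mpoly.span_superset by (rule inj_on_subset)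
  then show ?thesis
    using * finite_image_iff[OF injB] card_image[OF injB] card_image_le[OF finZ, of "sep e"] by simp
qed

lemma inj_on_sep: "inj_on (sep e) R"
  by (rule inj_onI) (metis sep(2) zero_neq_one)

text \<open>Every form \<open>f\<close> of degree \<open>e\<close> splits as
  \<open>interpolate e f\<close> plus a form vanishing on \<open>R\<close>, and interpolation fixes
  the span of the separators while killing vanishing forms.\<close>

lemma quotient_basis_sep: "quotient_basis {f. homogeneous e f} {f \<in> vanish. homogeneous e f} (sep e ` R)"
proof -
  interpret vector_space_pair scale_mpoly scale_mpoly by unfold_locales
  have id: "interpolate e f = f" if "f \<in> mpoly.span (sep e ` R)" for f
    using linear_eq_on[OF linear_interpolate _ that, of id] interpolate_sep
    by (auto simp: mpoly.linear_id)
  have ker: "interpolate e f = 0" if "f \<in> vanish" "homogeneous e f" for f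
    using homogeneous_vanish_iff[OF that(2)] that(1) by (simp add: interpolate_def mpoly.scale_zero_left)
  have sp: "interpolate e f \<in> mpoly.span (sep e ` R)" for f
    unfolding interpolate_def by (intro mpoly.span_sum mpoly.span_scale mpoly.span_base imageI)
  have sub: "mpoly.subspace {f. homogeneous e f}"
    unfolding mpoly.subspace_def by (auto intro: homogeneous_add homogeneous_scale)
  have hom: "homogeneous e f" if "f \<in> mpoly.span (sep e ` R)" for f
    using mpoly.span_minimal[OF _ sub, of "sep e ` R"] that sep by auto
  have "mpoly.independent (sep e ` R)"
  proof (rule mpoly.independent_if_scalars_zero)
    fix c x assume c: "(\<Sum>x\<in>sep e ` R. scale_mpoly (c x) x) = 0" and "x \<in> sep e ` R"
    then obtain v where v: "v \<in> R" "x = sep e v" by auto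
    have "0 = eval_mpoly (\<Sum>x\<in>sep e ` R. scale_mpoly (c x) x) v" by (simp add: c eval_mpoly_simps)
    also have "\<dots> = (\<Sum>w\<in>R. c (sep e w) * eval_mpoly (sep e w) v)"
      by (simp add: sum.reindex[OF inj_on_sep] eval_mpoly_simps)
    also have "\<dots> = (\<Sum>w\<in>R. if w = v then c x else 0)"
      using v by (intro sum.cong) (auto simp: sep)
    finally show "c x = 0" using v finite by simp
  qed (use finite in simp)
  moreover have "mpoly.span (sep e ` R) \<inter> {f \<in> vanish. homogeneous e f} = {0}"
    using id ker mpoly.span_zero by (force simp: vanish_def)
  moreover have "\<exists>u w. f = u + w \<and> u \<in> mpoly.span (sep e ` R) \<and> w \<in> {f \<in> vanish. homogeneous e f}"
    if "homogeneous e f" for f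
  proof (intro exI conjI)
    show "f = interpolate e f + (f - interpolate e f)" by simp
    show "f - interpolate e f \<in> {f \<in> vanish. homogeneous e f}"
      using homogeneous_vanish_iff[OF homogeneous_diff[OF that homogeneous_interpolate, of f]]
        homogeneous_diff[OF that homogeneous_interpolate, of f]
      by (auto simp: eval_mpoly_simps eval_interpolate)
  qed (rule sp)
  ultimately show ?thesis
    unfolding quotient_basis_def using sep(1) hom by (auto intro: homogeneous_add)
qed

text \<open>As \<open>quotient_dim\<close> picks an arbitrary quotient basis, all of them must be
  shown to have the size of the basis of separators.\<close>

lemma hilbert_function_vanish: "hilbert_function vanish e = card R"
proof -
  let ?V = "{f. homogeneous e f}" and ?W = "{f \<in> vanish. homogeneous e f}"
  interpret vector_space_pair scale_mpoly scale_mpoly by unfold_locales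
  have "card B = card R" if B: "quotient_basis ?V ?W B" for B
  proof (rule antisym)
    have sub: "mpoly.subspace {f. homogeneous e f}"
      unfolding mpoly.subspace_def by (auto intro: homogeneous_add homogeneous_scale)
    have homB: "homogeneous e f" if "f \<in> mpoly.span B" for f
      using mpoly.span_minimal[OF _ sub, of B] B that by (auto simp: quotient_basis_def)
    then have le: "finite B \<and> card B \<le> card R"
      using B by (intro card_le_of_independent_mod) (auto simp: quotient_basis_def)
    then show "card B \<le> card R" ..
    \<comment> \<open>\<open>B\<close> spans modulo vanishing forms, which interpolation kills; so
      the interpolants of \<open>B\<close> span all separators.\<close>
    have "sep e ` R \<subseteq> mpoly.span (interpolate e ` B)"
    proof (intro image_subsetI)
      fix v assume v: "v \<in> R"
      then obtain u w where uw: "sep e v = u + w" "u \<in> mpoly.span B" "w \<in> ?W"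
        using B sep(1)[OF v] unfolding quotient_basis_def by blast
      have "interpolate e w = 0"
        using homogeneous_vanish_iff[of e w] uw(3) by (simp add: interpolate_def mpoly.scale_zero_left)
      then have "sep e v = interpolate e u"
        using interpolate_sep[OF v] linear_add[OF linear_interpolate, of u w] uw(1) by simp
      then show "sep e v \<in> mpoly.span (interpolate e ` B)"
        using uw(2) linear_span_image[OF linear_interpolate, of B] by blast
    qed
    then have "card (sep e ` R) \<le> card (interpolate e ` B)"
      using quotient_basis_sep le mpoly.independent_span_bound[of "interpolate e ` B" "sep e ` R"]
      by (auto simp: quotient_basis_def)
    also have "\<dots> \<le> card B" using le by (intro card_image_le) auto
    finally show "card R \<le> card B" by (simp add: card_image[OF inj_on_sep])
  qed
  then show ?thesis
    unfolding hilbert_function_def quotient_dim_def using someI[of "quotient_basis ?V ?W", OF quotient_basis_sep] by blast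
qed

end

end

section \<open>Standard monomials\<close>

definition mdvd :: "'n monomial \<Rightarrow> 'n monomial \<Rightarrow> bool"
  where "mdvd a b \<longleftrightarrow> (\<forall>x. Poly_Mapping.lookup a x \<le> Poly_Mapping.lookup b x)"

lemma mdvd_iff: "mdvd a b \<longleftrightarrow> (\<exists>c. b = a + c)"
proof
  assume "mdvd a b"
  then have "b = a + (b - a)"
    by (intro poly_mapping_eqI) (simp add: lookup_add lookup_minus mdvd_def)
  then show "\<exists>c. b = a + c" ..
qed (auto simp: mdvd_def lookup_add)

lemma mdvd_trans: "mdvd a b \<Longrightarrow> mdvd b c \<Longrightarrow> mdvd a c"
  unfolding mdvd_def using order_trans by blast

text \<open>The polynomials all of whose monomials are multiples of elements of \<open>A\<close>
  form an ideal containing the generators.\<close>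

lemma keys_monomial_ideal:
  assumes "f \<in> Idl\<^bsub>\<S>\<^esub> {power_product a |a. a \<in> A}" "b \<in> Poly_Mapping.keys (f :: ('n, 'k::field) mpoly)"
  shows "\<exists>a\<in>A. mdvd a b"
proof -
  let ?J = "{f :: ('n, 'k) mpoly. \<forall>b\<in>Poly_Mapping.keys f. \<exists>a\<in>A. mdvd a b}"
  have "ideal ?J \<S>"
  proof (rule ideal_type_ringI)
    fix r x assume x: "x \<in> ?J"
    show "r * x \<in> ?J"
    proof (intro CollectI ballI)
      fix b assume "b \<in> Poly_Mapping.keys (r * x)"
      then obtain c e where ce: "b = c + e" "e \<in> Poly_Mapping.keys x" using keys_mult[of r x] by auto
      then obtain a where a: "a \<in> A" "mdvd a e" using x by auto
      have "mdvd e b" by (auto simp: mdvd_def ce(1) lookup_add)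
      then show "\<exists>a\<in>A. mdvd a b" using a mdvd_trans by blast
    qed
  qed (use Poly_Mapping.keys_add in \<open>fastforce+\<close>)
  moreover have "{power_product a |a. a \<in> A} \<subseteq> ?J"
    by (auto simp: power_product_def mdvd_def)
  ultimately show ?thesis using genideal_type_ring(3) assms by blast
qed

lemma power_product_in_monomial_ideal:
  assumes "a \<in> A" "mdvd a b"
  shows "power_product b \<in> Idl\<^bsub>\<S>\<^esub> {power_product a |a. a \<in> A}"
proof -
  obtain c where c: "b = a + c" using assms(2) mdvd_iff by blast
  have "power_product a \<in> Idl\<^bsub>\<S>\<^esub> {power_product a |a. a \<in> A}"
    using genideal_type_ring(2)[of "{power_product a |a. a \<in> A}"] assms(1) by blast
  then have "power_product c * power_product a \<in> Idl\<^bsub>\<S>\<^esub> {power_product a |a. a \<in> A}"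
    by (rule ideal_type_ringD(3)[OF genideal_type_ring(1)])
  then show ?thesis by (simp add: c power_product_def mult_single add.commute)
qed

lemma lookup_mult_sum:
  "Poly_Mapping.lookup (f * g) k = (\<Sum>a\<in>Poly_Mapping.keys f. \<Sum>b\<in>Poly_Mapping.keys g.
    if a + b = k then Poly_Mapping.lookup f a * Poly_Mapping.lookup g b else 0)"
proof -
  define F where "F a = Poly_Mapping.single a (Poly_Mapping.lookup f a)" for a
  define G where "G a = Poly_Mapping.single a (Poly_Mapping.lookup g a)" for a
  have "f = sum F (Poly_Mapping.keys f)" "g = sum G (Poly_Mapping.keys g)"
    unfolding F_def G_def by (rule poly_mapping_sum_single)+
  then have "f * g = (\<Sum>a\<in>Poly_Mapping.keys f. \<Sum>b\<in>Poly_Mapping.keys g. F a * G b)"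
    by (metis sum_product)
  then show ?thesis
    by (simp add: lookup_sum F_def G_def mult_single lookup_single when_def)
qed

section \<open>Initial monomials with respect to a monomial order\<close>

locale monomial_ordering =
  fixes lt :: "'n monomial \<Rightarrow> 'n monomial \<Rightarrow> bool"
  assumes order: "monomial_order lt"
begin

lemma lt_trans: "lt a b \<Longrightarrow> lt b c \<Longrightarrow> lt a c"
  and lt_total: "a \<noteq> b \<Longrightarrow> lt a b \<or> lt b a"
  and lt_wf: "wfp lt"
  and lt_add: "lt a b \<Longrightarrow> lt (a + c) (b + c)"
  using order by (auto simp: monomial_order_def transp_def totalp_on_def)

lemma lt_irrefl: "\<not> lt a a"
  using lt_wf by (metis wfp_imp_irreflp irreflpD)

lemma lt_add2:
  assumes "lt a a' \<or> a = a'" "lt b b' \<or> b = b'" "(a, b) \<noteq> (a', b')"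
  shows "lt (a + b) (a' + b')"
proof -
  have "lt (a + b) (a' + b) \<or> a = a'" "lt (a' + b) (a' + b') \<or> b = b'"
    using assms lt_add[of a a' b] lt_add[of b b' a'] by (auto simp: add.commute)
  then show ?thesis using assms(3) lt_trans by auto
qed

lemma ex_max:
  assumes "finite A" "A \<noteq> {}"
  shows "\<exists>a\<in>A. \<forall>b\<in>A. b \<noteq> a \<longrightarrow> lt b a"
  using assms
proof (induction A rule: finite_ne_induct)
  case (insert x F)
  then obtain a where a: "a \<in> F" "\<forall>b\<in>F. b \<noteq> a \<longrightarrow> lt b a" by blast
  show ?case
  proof (cases "lt x a")
    case False
    then have "lt a x" using a(1) insert.hyps lt_total by metis
    then have "lt b x" if "b \<in> F" for b using a(2) that lt_trans[of b a x] by metis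
    then show ?thesis by blast
  qed (use a in blast)
qed simp

lemma initial_monomial_eq:
  assumes "a \<in> Poly_Mapping.keys f" "\<And>b. b \<in> Poly_Mapping.keys f \<Longrightarrow> b \<noteq> a \<Longrightarrow> lt b a"
  shows "initial_monomial lt f = a"
  unfolding initial_monomial_def
proof (rule the_equality)
  fix c assume c: "c \<in> Poly_Mapping.keys f \<and> (\<forall>b\<in>Poly_Mapping.keys f. b \<noteq> c \<longrightarrow> lt b c)"
  show "c = a"
  proof (rule ccontr)
    assume "c \<noteq> a"
    then have "lt a c" "lt c a"
      using bspec[OF conjunct2[OF c] assms(1)] assms(2)[OF conjunct1[OF c]] by auto
    then show False using lt_trans lt_irrefl by metis
  qed
qed (use assms in auto)

lemma initial_monomial:
  assumes "f \<noteq> 0"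
  shows "initial_monomial lt f \<in> Poly_Mapping.keys f"
    and "b \<in> Poly_Mapping.keys f \<Longrightarrow> lt b (initial_monomial lt f) \<or> b = initial_monomial lt f"
proof -
  have "Poly_Mapping.keys f \<noteq> {}" using assms by (metis keys_eq_empty)
  then obtain a where "a \<in> Poly_Mapping.keys f" "\<forall>b\<in>Poly_Mapping.keys f. b \<noteq> a \<longrightarrow> lt b a"
    using ex_max[of "Poly_Mapping.keys f"] by auto
  then show "initial_monomial lt f \<in> Poly_Mapping.keys f"
    "b \<in> Poly_Mapping.keys f \<Longrightarrow> lt b (initial_monomial lt f) \<or> b = initial_monomial lt f"
    using initial_monomial_eq by metis+
qed

text \<open>Every other pair of monomials of \<open>f\<close> and \<open>g\<close> has a product
  strictly below \<open>a + b\<close>, so nothing cancels the leading term.\<close>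

lemma initial_monomial_mult:
  fixes f g :: "('n, 'k::field) mpoly"
  assumes "f \<noteq> 0" "g \<noteq> 0"
  defines "a \<equiv> initial_monomial lt f" and "b \<equiv> initial_monomial lt g"
  shows "Poly_Mapping.lookup (f * g) (a + b) = Poly_Mapping.lookup f a * Poly_Mapping.lookup g b"
    and "f * g \<noteq> 0" and "initial_monomial lt (f * g) = a + b"
proof -
  note f = initial_monomial[OF assms(1), folded a_def] and g = initial_monomial[OF assms(2), folded b_def]
  have less: "lt (c + e) (a + b)" if "c \<in> Poly_Mapping.keys f" "e \<in> Poly_Mapping.keys g" "(c, e) \<noteq> (a, b)" for c e
    using lt_add2[OF f(2)[OF that(1)] g(2)[OF that(2)] that(3)] .
  have "Poly_Mapping.lookup (f * g) (a + b) =
      (\<Sum>c\<in>Poly_Mapping.keys f. \<Sum>e\<in>Poly_Mapping.keys g. if c = a \<and> e = b then Poly_Mapping.lookup f a * Poly_Mapping.lookup g b else 0)"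
    unfolding lookup_mult_sum
  proof (intro sum.cong refl)
    fix c e assume "c \<in> Poly_Mapping.keys f" "e \<in> Poly_Mapping.keys g"
    then have "c + e = a + b \<longleftrightarrow> c = a \<and> e = b" using less[of c e] lt_irrefl[of "a + b"] by (cases "(c, e) = (a, b)") auto
    then show "(if c + e = a + b then Poly_Mapping.lookup f c * Poly_Mapping.lookup g e else 0) =
        (if c = a \<and> e = b then Poly_Mapping.lookup f a * Poly_Mapping.lookup g b else 0)" by simp
  qed
  also have "\<dots> = (\<Sum>c\<in>Poly_Mapping.keys f. if c = a then Poly_Mapping.lookup f a * Poly_Mapping.lookup g b else 0)"
    using g(1) by (intro sum.cong) auto
  also have "\<dots> = Poly_Mapping.lookup f a * Poly_Mapping.lookup g b"
    using f(1) by simp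
  finally show eq: "Poly_Mapping.lookup (f * g) (a + b) = Poly_Mapping.lookup f a * Poly_Mapping.lookup g b" .
  then have key: "a + b \<in> Poly_Mapping.keys (f * g)" using f(1) g(1) by (simp add: in_keys_iff)
  then show "f * g \<noteq> 0" by auto
  show "initial_monomial lt (f * g) = a + b"
  proof (rule initial_monomial_eq[OF key])
    fix k assume "k \<in> Poly_Mapping.keys (f * g)" "k \<noteq> a + b"
    then show "lt k (a + b)" using keys_mult[of f g] less by blast
  qed
qed

end

locale initial_monomials = point_set R + monomial_ordering lt
  for R :: "('k::field ^ 'n::finite) set" and lt :: "'n monomial \<Rightarrow> 'n monomial \<Rightarrow> bool" +
  fixes M :: "'n monomial set"
  assumes initial_ideal: "initial_ideal lt vanish = Idl\<^bsub>\<S>\<^esub> {power_product a |a. a \<in> M}"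
begin

text \<open>Stated through the given generators \<open>M\<close>. Since \<open>M\<close> and the
  initial monomials of \<open>vanish\<close> generate the same monomial ideal, they have the same
  multiples; the next lemmas use this to move between the two.\<close>

definition standard :: "'n monomial \<Rightarrow> bool"
  where "standard b \<longleftrightarrow> (\<forall>a\<in>M. \<not> mdvd a b)"

lemma initial_ideal_eq:
  "initial_ideal lt vanish = Idl\<^bsub>\<S>\<^esub> {power_product a |a. a \<in> initial_monomial lt ` (vanish - {0})}"
  unfolding initial_ideal_def by (rule arg_cong[of _ _ "genideal \<S>"]) blast

lemma not_standard_initial_monomial:
  assumes "h \<in> vanish" "h \<noteq> 0"
  shows "\<not> standard (initial_monomial lt h)"
proof -
  have "power_product (initial_monomial lt h) \<in> initial_ideal lt vanish"
    unfolding initial_ideal_eq using assms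
    by (intro power_product_in_monomial_ideal[of "initial_monomial lt h"]) (auto simp: mdvd_def)
  then show ?thesis
    unfolding initial_ideal standard_def
    using keys_monomial_ideal[of "power_product (initial_monomial lt h)" M "initial_monomial lt h"]
    by (auto simp: power_product_def)
qed

lemma not_standardE:
  assumes "\<not> standard b"
  obtains h where "h \<in> vanish" "h \<noteq> 0" "mdvd (initial_monomial lt h) b"
proof -
  obtain a where a: "a \<in> M" "mdvd a b" using assms by (auto simp: standard_def)
  have "power_product a \<in> initial_ideal lt vanish"
    unfolding initial_ideal using a(1) by (intro power_product_in_monomial_ideal[of a]) (auto simp: mdvd_def)
  then have "\<exists>c\<in>initial_monomial lt ` (vanish - {0}). mdvd c a"
    unfolding initial_ideal_eq using keys_monomial_ideal[of "power_product a" _ a]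
    by (auto simp: power_product_def)
  then show ?thesis using that a(2) mdvd_trans by blast
qed

text \<open>Applied twice: with \<open>g = 1\<close>, to bound the standard monomials of one degree,
  and with the normal form of \<open>f\<close>, where \<open>Z\<close> consists of the points at
  which \<open>f\<close> does not vanish.\<close>

lemma card_standard_multiples_le:
  assumes g: "homogeneous d g" "g \<noteq> 0"
    and C: "finite C" "\<And>c. c \<in> C \<Longrightarrow> mdeg c = m \<and> standard (initial_monomial lt g + c)"
    and Z: "Z \<subseteq> R" "\<And>v. v \<in> R - Z \<Longrightarrow> eval_mpoly g v = 0"
    and e: "card R \<le> d + m"
  shows "card C \<le> card Z"
proof -
  \<comment> \<open>A nonzero \<open>g * q\<close> would have a standard initial monomial and so lie
    outside \<open>vanish\<close>. This one fact yields distinctness, independence and independence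
    modulo \<open>vanish\<close> of the multiples of \<open>g\<close>.\<close>
  have notin: "q = 0" if "Poly_Mapping.keys q \<subseteq> C" "g * q \<in> vanish" for q
  proof (rule ccontr)
    assume q: "q \<noteq> 0"
    have "standard (initial_monomial lt (g * q))"
      unfolding initial_monomial_mult(3)[OF g(2) q] using C(2) initial_monomial(1)[OF q] that(1) by blast
    then show False
      using not_standard_initial_monomial[OF that(2) initial_monomial_mult(2)[OF g(2) q]] by blast
  qed
  have zero: "0 \<in> vanish" by (simp add: vanish_def)
  define b where "b c = g * power_product c" for c
  have inj: "inj_on b C"
  proof (rule inj_onI)
    fix c c' assume c: "c \<in> C" "c' \<in> C" "b c = b c'"
    let ?q = "power_product c - power_product c' :: ('n, 'k) mpoly"
    have "Poly_Mapping.keys ?q \<subseteq> C" using c keys_diff[of "power_product c" "power_product c'"]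
      by (fastforce simp: power_product_def)
    moreover have "g * ?q = 0" using c(3) by (simp add: b_def right_diff_distrib)
    then have "g * ?q \<in> vanish" using zero by (simp only:)
    ultimately have "?q = 0" by (rule notin)
    then show "c = c'" by (simp add: power_product_def) (metis inj_single injD lookup_single_eq lookup_single_not_eq zero_neq_one)
  qed
  have "finite (b ` C) \<and> card (b ` C) \<le> card Z"
  proof (rule card_le_of_independent_mod[OF e])
    show "homogeneous (d + m) x" if "x \<in> b ` C" for x
      using that C(2) g(1) by (auto simp: b_def power_product_def intro!: homogeneous_mult homogeneous_single)
    show "mpoly.independent (b ` C)"
    proof (rule mpoly.independent_if_scalars_zero)
      fix u x assume u: "(\<Sum>x\<in>b ` C. scale_mpoly (u x) x) = 0" and "x \<in> b ` C"
      then obtain c where c: "c \<in> C" "x = b c" by auto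
      define q where "q = (\<Sum>c\<in>C. Poly_Mapping.single c (u (b c)))"
      have look: "Poly_Mapping.lookup q a = (if a \<in> C then u (b a) else 0)" for a
        using C(1) by (auto simp: q_def lookup_sum lookup_single when_def)
      have "g * q = (\<Sum>c\<in>C. scale_mpoly (u (b c)) (b c))"
        unfolding q_def sum_distrib_left
        by (intro sum.cong) (simp_all add: b_def scale_mpoly_def power_product_def mult_single mult.left_commute)
      also have "\<dots> = 0" using u by (simp add: sum.reindex[OF inj])
      finally have "g * q \<in> vanish" using zero by (simp only:)
      moreover have "Poly_Mapping.keys q \<subseteq> C"
        by (auto simp: in_keys_iff look split: if_splits)
      ultimately have "q = 0" using notin by blast
      then show "u x = 0" using look[of c] c by simp
    qed (use C in simp)
    show "mpoly.span (b ` C) \<inter> vanish \<subseteq> {0}"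
    proof
      fix x assume x: "x \<in> mpoly.span (b ` C) \<inter> vanish"
      let ?S = "{g * q |q. Poly_Mapping.keys q \<subseteq> C}"
      have "mpoly.subspace ?S"
        unfolding mpoly.subspace_def
      proof (intro conjI ballI allI)
        show "0 \<in> ?S" by (intro CollectI exI[of _ 0]) simp
        show "x + y \<in> ?S" if xy: "x \<in> ?S" "y \<in> ?S" for x y
        proof -
          obtain p q where "x = g * p" "y = g * q" "Poly_Mapping.keys p \<subseteq> C" "Poly_Mapping.keys q \<subseteq> C"
            using xy by blast
          then show ?thesis using Poly_Mapping.keys_add[of p q]
            by (intro CollectI exI[of _ "p + q"]) (auto simp: distrib_left)
        qed
        show "scale_mpoly c x \<in> ?S" if xy: "x \<in> ?S" for c x
        proof -
          obtain p where "x = g * p" "Poly_Mapping.keys p \<subseteq> C" using xy by blast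
          then show ?thesis using keys_mult[of "Poly_Mapping.single 0 c" p]
            by (intro CollectI exI[of _ "scale_mpoly c p"])
              (auto simp: scale_mpoly_def mult.left_commute split: if_splits)
        qed
      qed
      moreover have "b ` C \<subseteq> ?S"
        by (auto simp: b_def power_product_def)
      ultimately have "x \<in> ?S" using mpoly.span_minimal x by blast
      then obtain q where q: "x = g * q" "Poly_Mapping.keys q \<subseteq> C" by blast
      then have "q = 0" using notin x by blast
      then show "x \<in> {0}" using q by simp
    qed
    show "eval_mpoly x v = 0" if "x \<in> b ` C" "v \<in> R - Z" for x v
      using that Z(2) by (auto simp: b_def eval_mpoly_simps)
  qed (rule Z(1))
  then show ?thesis by (simp add: card_image[OF inj])
qed

text \<open>Among the forms of degree \<open>d\<close> congruent to \<open>f\<close>, one with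
  minimal initial monomial works: a nonstandard initial monomial could be cancelled by a multiple of
  an element of \<open>vanish\<close>.\<close>

lemma normal_form:
  assumes "homogeneous d f" "f \<notin> vanish"
  obtains g where "homogeneous d g" "g \<noteq> 0" "standard (initial_monomial lt g)" "f - g \<in> vanish"
proof -
  let ?Q = "\<lambda>g. homogeneous d g \<and> f - g \<in> vanish"
  have Q0: "g \<noteq> 0" if "?Q g" for g using that assms(2) by auto
  have "?Q f" using assms by (simp add: vanish_def)
  then have "initial_monomial lt ` {g. ?Q g} \<noteq> {}" by blast
  then have "\<exists>a\<in>initial_monomial lt ` {g. ?Q g}. \<forall>b. lt b a \<longrightarrow> b \<notin> initial_monomial lt ` {g. ?Q g}"
    by (rule iffD1[OF wfp_iff_ex_minimal lt_wf, rule_format])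
  then obtain a where a: "a \<in> initial_monomial lt ` {g. ?Q g}"
    "\<And>b. lt b a \<Longrightarrow> b \<notin> initial_monomial lt ` {g. ?Q g}"
    by (elim bexE) simp
  then obtain g where g: "?Q g" "initial_monomial lt g = a" by auto
  have "standard a"
  proof (rule ccontr)
    assume "\<not> standard a"
    then obtain h where h: "h \<in> vanish" "h \<noteq> 0" "mdvd (initial_monomial lt h) a" by (rule not_standardE)
    let ?b = "initial_monomial lt h"
    \<comment> \<open>\<open>h\<close> may be inhomogeneous; its component in the degree of its
      initial monomial keeps that monomial, stays in \<open>vanish\<close>, and makes the reduction
      preserve degree \<open>d\<close>.\<close>
    define h' where "h' = hom_component (mdeg ?b) h"
    have key': "Poly_Mapping.keys h' \<subseteq> Poly_Mapping.keys h" "?b \<in> Poly_Mapping.keys h'"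
      using initial_monomial(1)[OF h(2)] by (auto simp: h'_def in_keys_iff lookup_hom_component split: if_splits)
    then have h'0: "h' \<noteq> 0" by auto
    have lm': "initial_monomial lt h' = ?b"
      using key' initial_monomial(2)[OF h(2)] by (intro initial_monomial_eq) auto
    have h': "h' \<in> vanish" "homogeneous (mdeg ?b) h'"
      using h(1) by (simp_all add: h'_def hom_component_vanish homogeneous_hom_component)
    obtain c where c: "a = ?b + c" using h(3) mdvd_iff by blast
    \<comment> \<open>The factor for which \<open>h' * t\<close> has the same leading term as
      \<open>g\<close>.\<close>
    let ?u = "Poly_Mapping.lookup g a / Poly_Mapping.lookup h' ?b"
    define t where "t = Poly_Mapping.single c ?u"
    have ga: "a \<in> Poly_Mapping.keys g" using initial_monomial(1)[OF Q0[OF g(1)]] g(2) by simp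
    have u0: "?u \<noteq> 0" using ga key'(2) by (simp add: in_keys_iff)
    then have t0: "t \<noteq> 0" by (metis t_def lookup_single_eq lookup_zero)
    have lmt: "initial_monomial lt t = c" using u0 by (intro initial_monomial_eq) (auto simp: t_def)
    have p: "Poly_Mapping.lookup (h' * t) a = Poly_Mapping.lookup g a" "initial_monomial lt (h' * t) = a" "h' * t \<noteq> 0"
      using initial_monomial_mult[OF h'0 t0] key'(2) unfolding lm' lmt
      by (simp_all add: c[symmetric]) (simp add: t_def in_keys_iff)
    have "mdeg a = d" using ga g(1) by (auto simp: homogeneous_def)
    then have "homogeneous (mdeg ?b + mdeg c) g" using g(1) by (simp add: c mdeg_add)
    then have hom: "homogeneous d (g - h' * t)"
      using homogeneous_mult[OF h'(2), of "mdeg c" t] \<open>mdeg a = d\<close>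
      by (auto simp: c mdeg_add t_def intro!: homogeneous_diff homogeneous_single)
    have "h' * t \<in> vanish"
      using ideal_type_ringD(3)[OF ideal_vanish h'(1), of t] by (simp add: mult.commute)
    then have "(f - g) + h' * t \<in> vanish" using g(1) ideal_type_ringD(2)[OF ideal_vanish] by blast
    then have Q: "?Q (g - h' * t)" using hom by (simp add: algebra_simps)
    let ?r = "g - h' * t"
    have "initial_monomial lt ?r \<noteq> a"
      using initial_monomial(1)[OF Q0[OF Q]] p(1) by (auto simp: in_keys_iff lookup_minus)
    moreover have "lt (initial_monomial lt ?r) a \<or> initial_monomial lt ?r = a"
      using initial_monomial(1)[OF Q0[OF Q]] keys_diff[of g "h' * t"]
        initial_monomial(2)[OF Q0[OF g(1)]] initial_monomial(2)[OF p(3)] g(2) p(2) by auto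
    ultimately have "lt (initial_monomial lt ?r) a" by blast
    then show False using a(2) Q by blast
  qed
  moreover have "g \<noteq> 0" using g(1) by (rule Q0)
  ultimately show ?thesis using that[of g] g by simp
qed

end

section \<open>Dimension and degree\<close>

lemma prime_chain_subset:
  assumes "prime_chain R n P" "i \<le> j" "j \<le> n"
  shows "P i \<subseteq> P j"
  using assms(2,3)
proof (induction j rule: dec_induct)
  case (step m)
  have "P m \<subset> P (Suc m)" using assms(1) step.prems by (simp add: prime_chain_def)
  then show ?case using step by auto
qed simp

lemma (in cring) quotient_rcos_mem_iff:
  assumes "ideal I R" "ideal J R" "I \<subseteq> J" "x \<in> carrier R"
  shows "I +> x \<in> (+>) I ` J \<longleftrightarrow> x \<in> J"
proof
  assume "I +> x \<in> (+>) I ` J"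
  then obtain y where y: "y \<in> J" "I +> x = I +> y" by auto
  have yc: "y \<in> carrier R" using ideal.Icarr[OF assms(2) y(1)] .
  have "x \<ominus> y \<in> J"
    using quotient_eq_iff_same_a_r_cos[OF assms(1,4) yc] y(2) assms(3) by auto
  then have "(x \<ominus> y) \<oplus> y \<in> J"
    using y(1) additive_subgroup.a_closed[OF ideal.axioms(1)[OF assms(2)]] by blast
  moreover have "(x \<ominus> y) \<oplus> y = x"
    using assms(4) yc by algebra
  ultimately show "x \<in> J" by simp
qed simp

lemma (in cring) primeideal_quotient_image:
  assumes I: "ideal I R" and J: "primeideal J R" "I \<subseteq> J"
  shows "primeideal ((+>) I ` J) (R Quot I)"
proof (rule primeidealI)
  have J': "ideal J R" using J(1) by (simp add: primeideal_def)
  note mem = quotient_rcos_mem_iff[OF I J' J(2)]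
  show "ideal ((+>) I ` J) (R Quot I)" using I J' by (rule ring_ideal_imp_quot_ideal)
  show "cring (R Quot I)" using ideal.quotient_is_cring[OF I] is_cring by blast
  have carr: "carrier (R Quot I) = (+>) I ` carrier R"
    by (auto simp: FactRing_def A_RCOSETS_def')
  obtain x where "x \<in> carrier R" "x \<notin> J"
    using primeideal.I_notcarr[OF J(1)] ideal.Icarr[OF J'] by blast
  then have "I +> x \<in> carrier (R Quot I)" "I +> x \<notin> (+>) I ` J" using mem carr by simp_all
  then show "carrier (R Quot I) \<noteq> (+>) I ` J" by metis
  fix a b assume a: "a \<in> carrier (R Quot I)" and b: "b \<in> carrier (R Quot I)" and ab: "a \<otimes>\<^bsub>R Quot I\<^esub> b \<in> (+>) I ` J"
  obtain x where x: "a = I +> x" "x \<in> carrier R" using a unfolding carr by (rule imageE)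
  obtain y where y: "b = I +> y" "y \<in> carrier R" using b unfolding carr by (rule imageE)
  note xy = x(2) y(2) x(1) y(1)
  have "I +> (x \<otimes> y) \<in> (+>) I ` J"
    using ab ideal.rcoset_mult_add[OF I xy(1,2)] unfolding xy(3,4) by (simp add: FactRing_def)
  then have "x \<otimes> y \<in> J" using mem xy by simp
  then have "x \<in> J \<or> y \<in> J" by (rule primeideal.I_prime[OF J(1) xy(1,2)])
  then show "a \<in> (+>) I ` J \<or> b \<in> (+>) I ` J" using xy(3,4) by auto
qed

text \<open>Correspondence of primes: preimages under the quotient map in one direction, images in
  the other, both preserving strict inclusions.\<close>

lemma (in cring) prime_chain_quotient_iff:
  assumes I: "ideal I R"
  shows "(\<exists>P. prime_chain (R Quot I) n P) \<longleftrightarrow> (\<exists>Q. prime_chain R n Q \<and> I \<subseteq> Q 0)"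
proof
  assume "\<exists>P. prime_chain (R Quot I) n P"
  then obtain P where P: "prime_chain (R Quot I) n P" ..
  define Q where "Q i = {r \<in> carrier R. I +> r \<in> P i}" for i
  have "primeideal (Q i) R" if "i \<le> n" for i
    unfolding Q_def using P that is_cring
    by (intro ring_hom_ring.primeideal_vimage[OF ideal.rcos_ring_hom_ring[OF I]]) (auto simp: prime_chain_def)
  moreover have "Q i \<subset> Q (Suc i)" if "i < n" for i
  proof -
    have sub: "P i \<subset> P (Suc i)" using P that by (simp add: prime_chain_def)
    then obtain a where a: "a \<in> P (Suc i)" "a \<notin> P i" by blast
    have "ideal (P (Suc i)) (R Quot I)" using P that by (simp add: prime_chain_def primeideal_def)
    then have "a \<in> carrier (R Quot I)" using a(1) ideal.Icarr by metis
    then obtain x where "x \<in> carrier R" "a = I +> x" by (auto simp: FactRing_def A_RCOSETS_def')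
    then have "x \<in> Q (Suc i)" "x \<notin> Q i" using a by (auto simp: Q_def)
    moreover have "Q i \<subseteq> Q (Suc i)" using sub by (auto simp: Q_def)
    ultimately show ?thesis by blast
  qed
  moreover have "I \<subseteq> Q 0"
  proof
    fix x assume x: "x \<in> I"
    have P0: "ideal (P 0) (R Quot I)" using P by (simp add: prime_chain_def primeideal_def)
    have "I +> x = \<zero>\<^bsub>R Quot I\<^esub>"
      using ideal.rcos_const_imp_mem[OF I] x ideal.Icarr[OF I x]
      by (simp add: FactRing_def a_coset_join2 ideal.axioms(1)[OF I] additive_subgroup.a_subgroup[OF ideal.axioms(1)[OF I]])
    then show "x \<in> Q 0"
      using additive_subgroup.zero_closed[OF ideal.axioms(1)[OF P0]] ideal.Icarr[OF I x] by (simp add: Q_def)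
  qed
  ultimately show "\<exists>Q. prime_chain R n Q \<and> I \<subseteq> Q 0"
    unfolding prime_chain_def by blast
next
  assume "\<exists>Q. prime_chain R n Q \<and> I \<subseteq> Q 0"
  then obtain Q where Q: "prime_chain R n Q" "I \<subseteq> Q 0" by blast
  have sub: "I \<subseteq> Q i" if "i \<le> n" for i
    using prime_chain_subset[OF Q(1), of 0 i] Q(2) that by auto
  have id: "ideal (Q i) R" if "i \<le> n" for i using Q(1) that by (simp add: prime_chain_def primeideal_def)
  have "(+>) I ` Q i \<subset> (+>) I ` Q (Suc i)" if i: "i < n" for i
  proof -
    have ss: "Q i \<subset> Q (Suc i)" using Q(1) i by (simp add: prime_chain_def)
    then obtain x where x: "x \<in> Q (Suc i)" "x \<notin> Q i" by blast
    then have "x \<in> carrier R" using ideal.Icarr[OF id[of "Suc i"]] i by simp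
    then have "I +> x \<notin> (+>) I ` Q i"
      using quotient_rcos_mem_iff[OF I id[of i] sub[of i]] x(2) i by simp
    then show ?thesis using x(1) ss by blast
  qed
  moreover have "primeideal ((+>) I ` Q i) (R Quot I)" if "i \<le> n" for i
    using Q(1) that sub by (intro primeideal_quotient_image I) (auto simp: prime_chain_def)
  ultimately have "prime_chain (R Quot I) n (\<lambda>i. (+>) I ` Q i)"
    unfolding prime_chain_def by blast
  then show "\<exists>P. prime_chain (R Quot I) n P" by blast
qed

section \<open>Primes above the ideal of a point\<close>

lemma primeideal_type_ringI:
  fixes J :: "'a::comm_ring_1 set"
  assumes "ideal J ring_of_type_algebra" "1 \<notin> J" "\<And>x y. x * y \<in> J \<Longrightarrow> x \<in> J \<or> y \<in> J"
  shows "primeideal J ring_of_type_algebra"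
  using assms by (intro primeidealI cring_from_type_algebra) auto

lemma primeideal_type_ringD:
  fixes J :: "'a::comm_ring_1 set"
  assumes "primeideal J ring_of_type_algebra"
  shows "ideal J ring_of_type_algebra" "1 \<notin> J" "x * y \<in> J \<Longrightarrow> x \<in> J \<or> y \<in> J"
proof -
  show I: "ideal J ring_of_type_algebra" using assms by (simp add: primeideal_def)
  show "1 \<notin> J"
    using primeideal.I_notcarr[OF assms] ideal_type_ringD(3)[OF I, of 1] by auto
  show "x * y \<in> J \<Longrightarrow> x \<in> J \<or> y \<in> J"
    using primeideal.I_prime[OF assms, of x y] by simp
qed

text \<open>A variable \<open>t_i\<close> with \<open>v $ i \<noteq> 0\<close> maps to a nonzero
  multiple of \<open>x\<close>, so its rescaled powers hit every monomial of
  \<open>K[x]\<close>.\<close>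

lemma line_eval_surj:
  assumes "v \<noteq> 0"
  obtains f where "line_eval v f = g"
proof -
  obtain i where i: "v $ i \<noteq> 0" using assms by (auto simp: vec_eq_iff)
  have d: "mdeg (Poly_Mapping.single i n) = n" for n
    by (simp add: mdeg_def lookup_single when_def)
  have p: "(\<Prod>j\<in>UNIV. (v $ j) ^ Poly_Mapping.lookup (Poly_Mapping.single i n) j) = v $ i ^ n" for n
    by (subst prod.remove[of _ i]) (auto simp: lookup_single when_def)
  have "line_eval v (\<Sum>n\<le>degree g. Poly_Mapping.single (Poly_Mapping.single i n) (coeff g n / v $ i ^ n)) = g"
    unfolding line_eval_sum line_eval_single p d using i by (simp add: poly_as_sum_of_monoms)
  then show ?thesis by (rule that)
qed

text \<open>An ideal strictly above the ideal of a point is, through \<^const>\<open>line_eval\<close>, a nonzero ideal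
  of the principal ideal domain \<open>K[x]\<close>.\<close>

lemma ideal_above_point_principal:
  fixes v :: "'k::field ^ 'n::finite"
  assumes v: "v \<noteq> 0" and J: "ideal J \<S>" "{f. line_eval v f = 0} \<subset> J"
  obtains g where "g \<in> J" "line_eval v g \<noteq> 0" "\<And>h. h \<in> J \<longleftrightarrow> line_eval v g dvd line_eval v h"
proof -
  let ?N = "\<lambda>g. g \<in> J \<and> line_eval v g \<noteq> 0"
  obtain g0 where "?N g0" using J(2) by blast
  then obtain g where g: "?N g" "\<And>h. ?N h \<Longrightarrow> degree (line_eval v g) \<le> degree (line_eval v h)"
    using ex_has_least_nat[of ?N g0 "\<lambda>g. degree (line_eval v g)"] by blast
  have "h \<in> J \<longleftrightarrow> line_eval v g dvd line_eval v h" for h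
  proof
    assume h: "h \<in> J"
    \<comment> \<open>Lifts the Euclidean quotient; the remainder comes from an element of
      \<open>J\<close>, so minimality of the degree forces it to be 0.\<close>
    obtain r where r: "line_eval v r = line_eval v h div line_eval v g" using line_eval_surj[OF v] .
    have "h - r * g \<in> J" using J(1) h g(1) ideal_type_ringD(3,4) by blast
    moreover have eq: "line_eval v (h - r * g) = line_eval v h mod line_eval v g"
      by (simp add: line_eval_diff line_eval_mult r minus_div_mult_eq_mod)
    ultimately have "line_eval v h mod line_eval v g = 0"
      using g(2)[of "h - r * g"] g(1) degree_mod_less[of "line_eval v g" "line_eval v h"] by fastforce
    then show "line_eval v g dvd line_eval v h" by (rule mod_0_imp_dvd)
  next
    assume "line_eval v g dvd line_eval v h"
    then obtain q where q: "line_eval v h = line_eval v g * q" ..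
    obtain r where r: "line_eval v r = q" using line_eval_surj[OF v] .
    have "line_eval v (h - r * g) = 0" by (simp add: line_eval_diff line_eval_mult r q)
    then have "h - r * g \<in> J" using J(2) by blast
    moreover have "r * g \<in> J" using ideal_type_ringD(3)[OF J(1)] g(1) by blast
    ultimately have "(h - r * g) + r * g \<in> J" by (rule ideal_type_ringD(2)[OF J(1)])
    then show "h \<in> J" by simp
  qed
  then show ?thesis using that g(1) by blast
qed

text \<open>Nonzero primes of \<open>K[x]\<close> are maximal. The generator of \<open>p\<close>
  factors as \<open>h * c\<close> through that of \<open>q\<close>; primality puts \<open>h\<close>
  in \<open>p\<close>, giving \<open>q \<subseteq> p\<close>, or \<open>c\<close> in
  \<open>p\<close>, making \<open>h\<close> a unit.\<close>

lemma no_prime_chain_above_point: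
  fixes v :: "'k::field ^ 'n::finite"
  assumes v: "v \<noteq> 0" and p: "primeideal p \<S>" and q: "primeideal q \<S>"
    and sub: "{f. line_eval v f = 0} \<subset> p" "p \<subset> q"
  shows False
proof -
  obtain g where g: "g \<in> p" "line_eval v g \<noteq> 0" "\<And>h. h \<in> p \<longleftrightarrow> line_eval v g dvd line_eval v h"
    using ideal_above_point_principal[OF v primeideal_type_ringD(1)[OF p] sub(1)] by blast
  have subq: "{f. line_eval v f = 0} \<subset> q" using sub by blast
  obtain h where h: "h \<in> q" "line_eval v h \<noteq> 0" "\<And>f. f \<in> q \<longleftrightarrow> line_eval v h dvd line_eval v f"
    using ideal_above_point_principal[OF v primeideal_type_ringD(1)[OF q] subq] by blast
  have "line_eval v h dvd line_eval v g" using g(1) h(3) sub(2) by blast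
  then obtain C where C: "line_eval v g = line_eval v h * C" ..
  obtain c where c: "line_eval v c = C" using line_eval_surj[OF v] .
  have "h * c \<in> p" unfolding g(3) by (simp add: line_eval_mult c C)
  then consider "h \<in> p" | "c \<in> p" using primeideal_type_ringD(3)[OF p] by blast
  then show False
  proof cases
    case 1
    then have "line_eval v g dvd line_eval v h" using g(3) by blast
    then have "q \<subseteq> p" using g(3) h(3) dvd_trans by blast
    then show False using sub(2) by blast
  next
    case 2
    then obtain D where D: "C = line_eval v g * D" using g(3) c by (auto elim: dvdE)
    have "line_eval v g * 1 = line_eval v h * C" by (simp only: C mult_1_right)
    also have "\<dots> = line_eval v g * (line_eval v h * D)" by (simp only: D mult.left_commute)
    finally have "1 = line_eval v h * D" using g(2) by (simp only: mult_left_cancel not_False_eq_True)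
    then have "1 \<in> q" unfolding h(3) line_eval_one by (metis dvd_triv_left)
    then show False using primeideal_type_ringD(2)[OF q] by blast
  qed
qed

context point_set
begin

text \<open>Otherwise choose for each point an element of its ideal outside \<open>p\<close>; the
  product vanishes at all points, so it lies in \<open>p\<close>, against primality.\<close>

lemma prime_above_vanish:
  assumes p: "primeideal p \<S>" "vanish \<subseteq> p"
  obtains v where "v \<in> R" "{f. line_eval v f = 0} \<subseteq> p"
proof -
  have "\<exists>v\<in>R. {f. line_eval v f = 0} \<subseteq> p"
  proof (rule ccontr)
    assume "\<not> ?thesis"
    then have "\<forall>v\<in>R. \<exists>f. line_eval v f = 0 \<and> f \<notin> p" by blast
    then obtain F where F: "\<And>v. v \<in> R \<Longrightarrow> line_eval v (F v) = 0 \<and> F v \<notin> p" by metis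
    have "line_eval v (prod F R) = 0" if "v \<in> R" for v
      unfolding line_eval_prod using F that finite by (intro prod_zero) auto
    then have "prod F R \<in> p" using p(2) by (auto simp: vanish_def)
    moreover have "prod F A \<notin> p" if "A \<subseteq> R" "finite A" for A
      using that(2,1)
    proof (induction A rule: finite_induct)
      case empty
      then show ?case using primeideal_type_ringD(2)[OF p(1)] by simp
    next
      case (insert x A)
      then show ?case using primeideal_type_ringD(3)[OF p(1), of "F x" "prod F A"] F by auto
    qed
    ultimately show False using finite by blast
  qed
  then show ?thesis using that by blast
qed

text \<open>A chain of three primes containing \<open>vanish\<close> starts above the ideal of some
  point, which leaves two nested primes strictly above that ideal. A chain of two starts at the
  ideal of a point.\<close>

lemma krull_dim_quotient_vanish:
  assumes "R \<noteq> {}"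
  shows "krull_dim (\<S> Quot vanish) = 1"
proof -
  interpret S: cring "\<S> :: ('n, 'k) mpoly ring" by (rule cring_from_type_algebra)
  note iff = S.prime_chain_quotient_iff[OF ideal_vanish]
  have "n \<le> 1" if chain: "\<exists>P. prime_chain (\<S> Quot vanish) n P" for n
  proof (rule ccontr)
    assume n: "\<not> n \<le> 1"
    obtain Q where Q: "prime_chain \<S> n Q" "vanish \<subseteq> Q 0" using iffD1[OF iff chain] by (elim exE conjE)
    have pr: "primeideal (Q i) \<S>" if "i \<le> 2" for i using Q(1) n that by (simp add: prime_chain_def)
    have "Q 0 \<subset> Q (Suc 0)" "Q (Suc 0) \<subset> Q (Suc 1)" using Q(1) n by (simp_all add: prime_chain_def)
    moreover obtain v where v: "v \<in> R" "{f. line_eval v f = 0} \<subseteq> Q 0"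
      using prime_above_vanish[OF pr[of 0] Q(2)] by auto
    ultimately show False
      using no_prime_chain_above_point[OF nonzero[OF v(1)] pr[of 1] pr[of 2]] by (auto simp: numeral_2_eq_2)
  qed
  moreover have "\<exists>P. prime_chain (\<S> Quot vanish) 1 P"
  proof -
    obtain v where v: "v \<in> R" using assms by blast
    define p where "p = {f. line_eval v f = 0}"
    \<comment> \<open>The irrelevant maximal ideal: the value at 0 is the constant term of
      \<open>f\<close>.\<close>
    define m where "m = {f. poly (line_eval v f) 0 = 0}"
    have "primeideal p \<S>" unfolding p_def
      by (intro primeideal_type_ringI ideal_type_ringI) (auto simp: line_eval_add line_eval_mult)
    moreover have "primeideal m \<S>" unfolding m_def
      by (intro primeideal_type_ringI ideal_type_ringI) (auto simp: line_eval_add line_eval_mult)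
    moreover have "p \<subset> m"
    proof -
      obtain f where f: "line_eval v f = [:0, 1:]" using line_eval_surj[OF nonzero[OF v]] .
      then have "f \<in> m" "f \<notin> p" by (auto simp: m_def p_def)
      moreover have "p \<subseteq> m" by (auto simp: m_def p_def)
      ultimately show ?thesis by blast
    qed
    ultimately have "prime_chain \<S> 1 (\<lambda>i. if i = 0 then p else m)"
      by (auto simp: prime_chain_def)
    moreover have "vanish \<subseteq> p" using v by (auto simp: vanish_def p_def)
    ultimately show ?thesis unfolding iff by (intro exI[of _ "\<lambda>i. if i = 0 then p else m"]) simp
  qed
  ultimately show ?thesis
    unfolding krull_dim_def one_enat_def
    by (intro antisym SUP_least SUP_upper) auto
qed

text \<open>In dimension 1 the normalizing factors are \<open>fact 0\<close> and
  \<open>d ^ 0\<close>, and the Hilbert function is eventually constant.\<close>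

lemma quotient_degree_vanish:
  assumes "R \<noteq> {}"
  shows "quotient_degree vanish = real (card R)"
proof -
  have "(\<lambda>d. real (hilbert_function vanish d) / real d ^ 0) \<longlonglongrightarrow> real (card R)"
    by (rule tendsto_eventually, rule eventually_sequentiallyI[of "card R"])
      (simp add: hilbert_function_vanish)
  then show ?thesis
    unfolding quotient_degree_def krull_dim_quotient_vanish[OF assms]
    by (simp add: limI one_enat_def)
qed

end

section \<open>Counting standard multiples\<close>

lemma mdvd_supported:
  assumes "Poly_Mapping.keys a = {x}"
  shows "mdvd a b \<longleftrightarrow> Poly_Mapping.lookup a x \<le> Poly_Mapping.lookup b x"
proof -
  have "Poly_Mapping.lookup a y = 0" if "y \<noteq> x" for y
    using assms that not_in_keys_iff_lookup_eq_zero[of y a] by simp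
  then show ?thesis unfolding mdvd_def by (metis le0)
qed

lemma mdvd_supported2:
  assumes "Poly_Mapping.keys a \<subseteq> {x, y}"
  shows "mdvd a b \<longleftrightarrow> Poly_Mapping.lookup a x \<le> Poly_Mapping.lookup b x \<and>
    Poly_Mapping.lookup a y \<le> Poly_Mapping.lookup b y"
proof -
  have "Poly_Mapping.lookup a z = 0" if "z \<noteq> x" "z \<noteq> y" for z
    using assms that not_in_keys_iff_lookup_eq_zero[of z a] by blast
  then show ?thesis unfolding mdvd_def by (metis le0)
qed

lemma mdeg_split:
  fixes b :: "'n::finite monomial"
  assumes "p \<noteq> q" "bij_betw \<sigma> A (UNIV - {p, q})"
  shows "mdeg b = Poly_Mapping.lookup b p + Poly_Mapping.lookup b q + (\<Sum>i\<in>A. Poly_Mapping.lookup b (\<sigma> i))"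
proof -
  have "mdeg b = (\<Sum>y\<in>insert p (insert q (UNIV - {p, q})). Poly_Mapping.lookup b y)"
    unfolding mdeg_def by (rule sum.cong) auto
  also have "\<dots> = Poly_Mapping.lookup b p + (Poly_Mapping.lookup b q + (\<Sum>y\<in>UNIV - {p, q}. Poly_Mapping.lookup b y))"
    using assms(1) by simp
  also have "(\<Sum>y\<in>UNIV - {p, q}. Poly_Mapping.lookup b y) = (\<Sum>i\<in>A. Poly_Mapping.lookup b (\<sigma> i))"
    using sum.reindex_bij_betw[OF assms(2)] by metis
  finally show ?thesis by simp
qed

lemma monomial_with_exponents:
  obtains b :: "'n::finite monomial" where "\<And>x. Poly_Mapping.lookup b x = h x"
proof -
  have "Poly_Mapping.lookup (Abs_poly_mapping h) x = h x" for x by simp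
  then show ?thesis by (rule that)
qed

text \<open>For monomials of large degree \<open>e\<close> the exponents \<open>x i\<close> off \<open>{p, q}\<close> are chosen freely below
  the generators; the last parameter \<open>x j\<close> is the exponent at \<open>p\<close> if that is small, and
  otherwise determines the exponent at \<open>q\<close>. The remaining exponent fills up the degree.\<close>

lemma many_multiples:
  fixes \<alpha> :: "'i \<Rightarrow> 'n::finite monomial" and a :: "'n monomial"
  assumes A: "finite A" "j \<in> A" and pq: "p \<noteq> q"
    and bij: "bij_betw \<sigma> (A - {j}) (UNIV - {p, q})"
    and keys: "Poly_Mapping.keys (\<alpha> j) \<subseteq> {p, q}"
      "\<And>i. i \<in> A - {j} \<Longrightarrow> Poly_Mapping.keys (\<alpha> i) = {\<sigma> i}"
  defines "w \<equiv> (\<lambda>i. if i = j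
      then (Poly_Mapping.lookup (\<alpha> j) p - Poly_Mapping.lookup a p) + (Poly_Mapping.lookup (\<alpha> j) q - Poly_Mapping.lookup a q)
      else Poly_Mapping.lookup (\<alpha> i) (\<sigma> i) - Poly_Mapping.lookup a (\<sigma> i))"
  obtains e C where "N \<le> e" "finite C" "card C = prod w A"
    "\<And>c. c \<in> C \<Longrightarrow> mdeg c = e \<and> (\<forall>i\<in>A. \<not> mdvd (\<alpha> i) (a + c))"
proof -
  define u where "u = Poly_Mapping.lookup (\<alpha> j) p - Poly_Mapping.lookup a p"
  define v where "v = Poly_Mapping.lookup (\<alpha> j) q - Poly_Mapping.lookup a q"
  \<comment> \<open>Large enough that the subtractions from \<open>e\<close> in \<open>P\<close> and
    \<open>Q\<close> never truncate, and that the filling exponent at \<open>p\<close> is at least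
    \<open>u\<close>.\<close>
  define e where "e = N + sum w A + u + v"
  define E where "E = PiE A (\<lambda>i. {..<w i})"
  define rest where "rest x = (\<Sum>i\<in>A - {j}. x i)" for x :: "'i \<Rightarrow> nat"
  define P where "P x = (if x j < u then x j else e - rest x - (x j - u))" for x :: "'i \<Rightarrow> nat"
  define Q where "Q x = (if x j < u then e - rest x - x j else x j - u)" for x :: "'i \<Rightarrow> nat"
  have wj: "w j = u + v" by (simp add: w_def u_def v_def)
  have x: "x i < w i" if "x \<in> E" "i \<in> A" for x i using that by (auto simp: E_def PiE_def Pi_def)
  have rest: "rest x + x j \<le> sum w A" if "x \<in> E" for x
  proof -
    have "rest x + x j = sum x A" using A by (simp add: rest_def sum.remove)
    also have "\<dots> \<le> sum w A" using x[OF that] by (intro sum_mono) (auto intro: less_imp_le)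
    finally show ?thesis .
  qed
  define mon where "mon x = (SOME c. Poly_Mapping.lookup c p = P x \<and> Poly_Mapping.lookup c q = Q x \<and>
      (\<forall>i\<in>A - {j}. Poly_Mapping.lookup c (\<sigma> i) = x i))" for x
  have mon: "Poly_Mapping.lookup (mon x) p = P x \<and> Poly_Mapping.lookup (mon x) q = Q x \<and>
      (\<forall>i\<in>A - {j}. Poly_Mapping.lookup (mon x) (\<sigma> i) = x i)" for x
  proof -
    obtain c where c: "\<And>y. Poly_Mapping.lookup c y =
        (if y = p then P x else if y = q then Q x else x (inv_into (A - {j}) \<sigma> y))"
      using monomial_with_exponents[where h = "\<lambda>y. if y = p then P x else if y = q then Q x else x (inv_into (A - {j}) \<sigma> y)"]
      by metis
    have "Poly_Mapping.lookup c (\<sigma> i) = x i" if "i \<in> A - {j}" for i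
    proof -
      have "\<sigma> i \<in> UNIV - {p, q}" using bij that by (auto simp: bij_betw_def)
      moreover have "inv_into (A - {j}) \<sigma> (\<sigma> i) = i" using bij that by (simp add: bij_betw_def)
      ultimately show ?thesis by (simp add: c)
    qed
    moreover have "Poly_Mapping.lookup c p = P x" "Poly_Mapping.lookup c q = Q x"
      using pq unfolding c by simp_all
    ultimately have "Poly_Mapping.lookup c p = P x \<and> Poly_Mapping.lookup c q = Q x \<and>
        (\<forall>i\<in>A - {j}. Poly_Mapping.lookup c (\<sigma> i) = x i)" by blast
    then show ?thesis unfolding mon_def by (rule someI)
  qed
  \<comment> \<open>The exponent at \<open>p\<close> reveals which of the two cases produced the
    monomial; injectivity of \<open>mon\<close> rests on this.\<close>
  have P_iff: "P x < u \<longleftrightarrow> x j < u" if "x \<in> E" for x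
    using rest[OF that] by (auto simp: P_def e_def)
  have inj: "inj_on mon E"
  proof (rule inj_onI)
    fix x y assume xy: "x \<in> E" "y \<in> E" "mon x = mon y"
    have off: "x i = y i" if "i \<in> A - {j}" for i using mon[of x] mon[of y] xy(3) that by metis
    have PQ: "P x = P y" "Q x = Q y" using mon[of x] mon[of y] xy(3) by metis+
    have "x j = y j"
    proof (cases "x j < u")
      case True
      then have "y j < u" using P_iff xy PQ by metis
      then show ?thesis using True PQ(1) by (simp add: P_def)
    next
      case False
      then have "\<not> y j < u" using P_iff xy PQ by metis
      then show ?thesis using False PQ(2) by (simp add: Q_def)
    qed
    then show "x = y" using off xy(1,2) unfolding E_def by (intro PiE_ext) auto
  qed
  have "mdeg (mon x) = e \<and> (\<forall>i\<in>A. \<not> mdvd (\<alpha> i) (a + mon x))" if E: "x \<in> E" for x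
  proof (intro conjI ballI)
    have "mdeg (mon x) = P x + Q x + rest x"
      unfolding mdeg_split[OF pq bij] rest_def using mon by simp
    also have "\<dots> = e" using rest[OF E] by (auto simp: P_def Q_def e_def)
    finally show "mdeg (mon x) = e" .
    fix i assume i: "i \<in> A"
    show "\<not> mdvd (\<alpha> i) (a + mon x)"
    proof (cases "i = j")
      case True
      \<comment> \<open>If \<open>x j < u\<close>, the exponent at \<open>p\<close> stays below that
        of the generator; otherwise \<open>x j - u < v\<close> keeps the exponent at
        \<open>q\<close> below it.\<close>
      have "x j < u + v" using x[OF E A(2)] wj by simp
      then show ?thesis
        unfolding True mdvd_supported2[OF keys(1)] using mon[of x]
        by (auto simp: lookup_add P_def Q_def u_def v_def)
    next
      case False
      then have ij: "i \<in> A - {j}" using i by simp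
      show ?thesis
        unfolding mdvd_supported[OF keys(2)[OF ij]] using mon[of x] x[OF E i] ij False
        by (auto simp: lookup_add w_def)
    qed
  qed
  moreover have "finite (mon ` E)" using A by (auto simp: E_def intro!: finite_PiE)
  moreover have "card (mon ` E) = prod w A"
    using card_image[OF inj] A by (simp add: E_def card_PiE)
  moreover have "N \<le> e" by (simp add: e_def)
  ultimately show ?thesis using that[of e "mon ` E"] by blast
qed

context initial_monomials
begin

text \<open>Otherwise all monomials in two variables would be standard, but there are at most
  \<open>card R\<close> standard monomials in each large degree.\<close>

lemma generator_in_two_variables:
  assumes "p \<noteq> q"
  shows "\<exists>a\<in>M. Poly_Mapping.keys a \<subseteq> {p, q}"
proof (rule ccontr)
  assume none: "\<not> ?thesis"
  \<comment> \<open>For \<open>i \<le> card R\<close> these are \<open>card R + 1\<close> distinct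
    monomials of degree \<open>card R\<close>, one more than can be standard.\<close>
  define b where "b i = Poly_Mapping.single p i + Poly_Mapping.single q (card R - i)" for i
  have lb: "Poly_Mapping.lookup (b i) x = (if x = p then i else if x = q then card R - i else 0)" for i x
    using assms by (auto simp: b_def lookup_add lookup_single when_def)
  have inj: "inj_on b {..card R}"
    by (rule inj_onI) (metis lb)
  have md: "mdeg (b i) = card R" if "i \<le> card R" for i
    using that by (simp add: b_def mdeg_def lookup_add lookup_single when_def sum.distrib)
  have st: "standard (b i)" for i
    unfolding standard_def
  proof
    fix a assume "a \<in> M"
    then obtain x where x: "x \<in> Poly_Mapping.keys a" "x \<noteq> p" "x \<noteq> q" using none by blast
    then have "Poly_Mapping.lookup (b i) x = 0" "Poly_Mapping.lookup a x \<noteq> 0"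
      by (auto simp: lb in_keys_iff)
    then show "\<not> mdvd a (b i)" by (metis mdvd_def le_zero_eq)
  qed
  have lm: "initial_monomial lt (1 :: ('n, 'k) mpoly) = 0"
    by (rule initial_monomial_eq) auto
  have "card (b ` {..card R}) \<le> card R"
  proof (rule card_standard_multiples_le[of 0 1])
    show "mdeg c = card R \<and> standard (initial_monomial lt (1 :: ('n, 'k) mpoly) + c)" if "c \<in> b ` {..card R}" for c
      using that md st lm by auto
  qed auto
  then show False using card_image[OF inj] by simp
qed

end

text \<open>Chains three estimates: the greedy bound is at most the product of the
  \<open>\<delta> i - x i\<close>, this is at most the number \<open>prod w\<close> of standard
  multiples of the initial monomial \<open>a\<close>, and these multiples number at most the points
  where \<open>f\<close> is nonzero.\<close>

lemma (in initial_monomials) card_nonzero_ge: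
  fixes \<alpha> :: "nat \<Rightarrow> 'n monomial"
  assumes s: "s = CARD('n)" "2 \<le> s"
    and M: "M = \<alpha> ` {2..s}"
    and \<delta>: "\<And>i. i \<in> {2..s} \<Longrightarrow> \<delta> i = mdeg (\<alpha> i)" "\<And>i. i \<in> {2..s} \<Longrightarrow> 1 \<le> \<delta> i"
      "\<And>i. i \<in> {2..<s} \<Longrightarrow> \<delta> i \<le> \<delta> (i + 1)"
    and k: "k \<le> s - 2" "d = (\<Sum>i=2..k+1. (\<delta> i - 1)) + l" "l \<le> \<delta> (k + 2) - 1"
    and f: "homogeneous d f" "f \<notin> vanish"
  shows "(\<delta> (k + 2) - l) * (\<Prod>i=k+3..s. \<delta> i) \<le> card {v \<in> R. eval_mpoly f v \<noteq> 0}"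
proof -
  let ?A = "{2..s}" and ?Z = "{v \<in> R. eval_mpoly f v \<noteq> 0}"
  have "Poly_Mapping.keys (\<alpha> i) \<noteq> {}" if "i \<in> ?A" for i
    using \<delta>(1,2)[OF that] by (auto simp: mdeg_def)
  moreover have "\<exists>i\<in>?A. Poly_Mapping.keys (\<alpha> i) \<subseteq> {p, q}" if "p \<noteq> q" for p q
    using generator_in_two_variables[OF that] unfolding M by blast
  moreover have "Suc (card ?A) = CARD('n)" "?A \<noteq> {}" using s by auto
  ultimately obtain p q j \<sigma> where pq: "p \<noteq> q" and j: "j \<in> ?A" and kj: "Poly_Mapping.keys (\<alpha> j) \<subseteq> {p, q}"
    and bij: "bij_betw \<sigma> (?A - {j}) (UNIV - {p, q})"
    and ki: "\<And>i. i \<in> ?A - {j} \<Longrightarrow> Poly_Mapping.keys (\<alpha> i) = {\<sigma> i}"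
    using support_structure[of ?A "\<lambda>i. Poly_Mapping.keys (\<alpha> i)"] by (metis finite_atLeastAtMost)
  obtain g where g: "homogeneous d g" "g \<noteq> 0" "standard (initial_monomial lt g)" "f - g \<in> vanish"
    using normal_form[OF f] .
  define a where "a = initial_monomial lt g"
  define w where "w = (\<lambda>i. if i = j
      then (Poly_Mapping.lookup (\<alpha> j) p - Poly_Mapping.lookup a p) + (Poly_Mapping.lookup (\<alpha> j) q - Poly_Mapping.lookup a q)
      else Poly_Mapping.lookup (\<alpha> i) (\<sigma> i) - Poly_Mapping.lookup a (\<sigma> i))"
  \<comment> \<open>A standard \<open>a\<close> may have a huge exponent at one of \<open>p\<close>,
    \<open>q\<close>, so their sum can exceed \<open>\<delta> j\<close>. Capping at
    \<open>\<delta> j - 1\<close> leaves a factor 1, still at most \<open>w j\<close>, and only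
    lowers the sum of the \<open>x i\<close>.\<close>
  define x where "x i = (if i = j then min (Poly_Mapping.lookup a p + Poly_Mapping.lookup a q) (\<delta> j - 1)
      else Poly_Mapping.lookup a (\<sigma> i))" for i
  have standard_iff: "standard b \<longleftrightarrow> (\<forall>i\<in>?A. \<not> mdvd (\<alpha> i) b)" for b
    unfolding standard_def by (simp add: M)
  have std: "\<not> mdvd (\<alpha> i) a" if "i \<in> ?A" for i using g(3) that by (simp add: standard_iff a_def)
  have da: "mdeg a = d" using g(1) initial_monomial(1)[OF g(2)] by (simp add: homogeneous_def a_def)
  have \<delta>j: "\<delta> j = Poly_Mapping.lookup (\<alpha> j) p + Poly_Mapping.lookup (\<alpha> j) q"
  proof -
    have "(\<Sum>i\<in>?A - {j}. Poly_Mapping.lookup (\<alpha> j) (\<sigma> i)) = 0"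
    proof (rule sum.neutral, rule ballI)
      fix i assume "i \<in> ?A - {j}"
      then have "\<sigma> i \<in> UNIV - {p, q}" by (rule bspec[OF bij_betwE[OF bij]])
      then have "\<sigma> i \<notin> {p, q}" by simp
      then show "Poly_Mapping.lookup (\<alpha> j) (\<sigma> i) = 0" using kj not_in_keys_iff_lookup_eq_zero[of "\<sigma> i" "\<alpha> j"] by blast
    qed
    then show ?thesis using \<delta>(1)[OF j] mdeg_split[OF pq bij, of "\<alpha> j"] by simp
  qed
  have \<delta>i: "\<delta> i = Poly_Mapping.lookup (\<alpha> i) (\<sigma> i)" if "i \<in> ?A - {j}" for i
  proof -
    have "\<delta> i = (\<Sum>y\<in>UNIV. Poly_Mapping.lookup (\<alpha> i) y)" using \<delta>(1) that by (simp add: mdeg_def)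
    also have "\<dots> = (\<Sum>y\<in>{\<sigma> i}. Poly_Mapping.lookup (\<alpha> i) y)"
      using ki[OF that] not_in_keys_iff_lookup_eq_zero[of _ "\<alpha> i"]
      by (intro sum.mono_neutral_right) simp_all
    finally show ?thesis by simp
  qed
  have xw: "x i < \<delta> i \<and> \<delta> i - x i \<le> w i" if i: "i \<in> ?A" for i
  proof (cases "i = j")
    case True
    have "\<not> (Poly_Mapping.lookup (\<alpha> j) p \<le> Poly_Mapping.lookup a p \<and> Poly_Mapping.lookup (\<alpha> j) q \<le> Poly_Mapping.lookup a q)"
      using std[OF j] mdvd_supported2[OF kj] by blast
    then have "1 \<le> w j" "\<delta> j - (Poly_Mapping.lookup a p + Poly_Mapping.lookup a q) \<le> w j"
      by (auto simp: w_def \<delta>j)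
    then show ?thesis using \<delta>(2)[OF j] True by (auto simp: x_def min_def)
  next
    case False
    then have ij: "i \<in> ?A - {j}" using i by simp
    have "Poly_Mapping.lookup a (\<sigma> i) < \<delta> i"
      using std[OF i] mdvd_supported[OF ki[OF ij]] \<delta>i[OF ij] by (simp add: not_le)
    then show ?thesis using False \<delta>i[OF ij] by (simp add: x_def w_def)
  qed
  have "(\<Sum>i\<in>?A. x i) = x j + (\<Sum>i\<in>?A - {j}. x i)" using j by (simp add: sum.remove)
  also have "(\<Sum>i\<in>?A - {j}. x i) = (\<Sum>i\<in>?A - {j}. Poly_Mapping.lookup a (\<sigma> i))"
    by (intro sum.cong) (auto simp: x_def)
  also have "x j + \<dots> \<le> d" using mdeg_split[OF pq bij, of a] da by (simp add: x_def)
  finally have "(\<Sum>i=2..s. x i) \<le> (\<Sum>i=2..k+1. (\<delta> i - 1)) + l" using k(2) by simp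
  then have "(\<delta> (k + 2) - l) * (\<Prod>i=k+3..s. \<delta> i) \<le> (\<Prod>i\<in>?A. \<delta> i - x i)"
    using xw by (intro prod_diff_ge \<delta>(3) s(2) k(1,3)) auto
  also have "\<dots> \<le> prod w ?A" using xw by (intro prod_mono) auto
  also have "\<dots> \<le> card ?Z"
  proof -
    obtain e C where C: "card R \<le> e" "finite C" "card C = prod w ?A"
      "\<And>c. c \<in> C \<Longrightarrow> mdeg c = e \<and> (\<forall>i\<in>?A. \<not> mdvd (\<alpha> i) (a + c))"
      using many_multiples[OF finite_atLeastAtMost j pq bij kj ki, where N = "card R" and a = a, folded w_def] by blast
    \<comment> \<open>\<open>f\<close> and its normal form take the same values on
      \<open>R\<close>.\<close>
    have "eval_mpoly g v = 0" if "v \<in> R - ?Z" for v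
      using homogeneous_vanish_iff[OF homogeneous_diff[OF f(1) g(1)]] g(4) that by (auto simp: eval_mpoly_simps)
    then have "card C \<le> card ?Z"
      using C by (intro card_standard_multiples_le[OF g(1,2) C(2), where m = e])
        (auto simp: standard_iff a_def)
    then show ?thesis using C(3) by simp
  qed
  finally show ?thesis .
qed

section \<open>Projective points\<close>

definition coord_vector :: "('k::field ^ 'n::finite) set \<Rightarrow> 'k ^ 'n"
  where "coord_vector P = (SOME v. v \<in> P)"

lemma projective_space_coord_vector:
  assumes "P \<in> projective_space"
  shows "coord_vector P \<noteq> 0" "w \<in> P \<longleftrightarrow> (\<exists>c. c \<noteq> 0 \<and> w = c *s coord_vector P)"
proof -
  obtain u where u: "u \<noteq> 0" "P = proportional `` {u}"
    using assms unfolding projective_space_def by (auto elim!: quotientE)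
  have mem: "w \<in> P \<longleftrightarrow> (\<exists>c. c \<noteq> 0 \<and> w = c *s u)" for w
    using u by (auto simp: proportional_def)
  then have "\<exists>v. v \<in> P" by (metis one_neq_zero)
  then have "coord_vector P \<in> P" unfolding coord_vector_def by (rule someI_ex)
  then obtain b where b: "b \<noteq> 0" "coord_vector P = b *s u" using mem by blast
  then show "coord_vector P \<noteq> 0" using u(1) by simp
  show "w \<in> P \<longleftrightarrow> (\<exists>c. c \<noteq> 0 \<and> w = c *s coord_vector P)"
  proof
    assume "w \<in> P"
    then obtain c where "c \<noteq> 0" "w = c *s u" using mem by blast
    then show "\<exists>c. c \<noteq> 0 \<and> w = c *s coord_vector P"
      using b by (intro exI[of _ "c / b"]) (simp add: vector_smult_assoc)
  next
    assume "\<exists>c. c \<noteq> 0 \<and> w = c *s coord_vector P"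
    then obtain c where "c \<noteq> 0" "w = c *s coord_vector P" by blast
    then show "w \<in> P" unfolding mem using b by (intro exI[of _ "c * b"]) (simp add: vector_smult_assoc)
  qed
qed

lemma vanishes_at_coord_vector:
  assumes "P \<in> projective_space" "homogeneous d f"
  shows "vanishes_at f P \<longleftrightarrow> eval_mpoly f (coord_vector P) = 0"
proof
  show "vanishes_at f P \<Longrightarrow> eval_mpoly f (coord_vector P) = 0"
    using projective_space_coord_vector(2)[OF assms(1), of "coord_vector P"]
    unfolding vanishes_at_def by (metis one_neq_zero vector_smult_lid)
  assume zero: "eval_mpoly f (coord_vector P) = 0"
  show "vanishes_at f P"
    unfolding vanishes_at_def
  proof
    fix v assume "v \<in> P"
    then obtain c where "v = c *s coord_vector P"
      using projective_space_coord_vector(2)[OF assms(1)] by blast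
    then show "eval_mpoly f v = 0" by (simp add: eval_mpoly_scale_arg[OF assms(2)] zero)
  qed
qed

lemma inj_on_coord_vector: "inj_on coord_vector (projective_space :: ('k::field ^ 'n::finite) set set)"
proof (rule inj_onI)
  fix P Q :: "('k ^ 'n) set"
  assume "P \<in> projective_space" "Q \<in> projective_space" "coord_vector P = coord_vector Q"
  then have "w \<in> P \<longleftrightarrow> w \<in> Q" for w by (simp add: projective_space_coord_vector(2))
  then show "P = Q" by blast
qed

text \<open>If one representative is a multiple of another, the factor is nonzero, so both span the
  same point and the choice of representative agrees.\<close>

lemma point_set_coord_vector:
  assumes "XX \<subseteq> projective_space" "finite XX"
  shows "point_set (coord_vector ` XX)"
proof
  show "finite (coord_vector ` XX)" using assms(2) by simp
  show "v \<noteq> 0" if "v \<in> coord_vector ` XX" for v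
    using that assms(1) by (elim imageE) (simp add: projective_space_coord_vector(1) subset_iff)
  fix v w c assume vw: "v \<in> coord_vector ` XX" "w \<in> coord_vector ` XX" "w = c *s v"
  then obtain P Q where P: "P \<in> projective_space" "v = coord_vector P" and Q: "Q \<in> projective_space" "w = coord_vector Q"
    using assms(1) by blast
  have c: "c \<noteq> 0" using vw(3) projective_space_coord_vector(1)[OF Q(1)] Q(2) by auto
  have "x \<in> Q \<longleftrightarrow> x \<in> P" for x
  proof -
    have "(\<exists>b. b \<noteq> 0 \<and> x = b *s w) \<longleftrightarrow> (\<exists>b. b \<noteq> 0 \<and> x = b *s v)"
    proof
      assume "\<exists>b. b \<noteq> 0 \<and> x = b *s w"
      then obtain b where "b \<noteq> 0" "x = b *s w" by blast
      then show "\<exists>b. b \<noteq> 0 \<and> x = b *s v" using c vw(3) by (intro exI[of _ "b * c"]) (simp add: vector_smult_assoc)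
    next
      assume "\<exists>b. b \<noteq> 0 \<and> x = b *s v"
      then obtain b where "b \<noteq> 0" "x = b *s v" by blast
      then show "\<exists>b. b \<noteq> 0 \<and> x = b *s w" using c vw(3) by (intro exI[of _ "b / c"]) (simp add: vector_smult_assoc)
    qed
    then show ?thesis using projective_space_coord_vector(2) P Q by metis
  qed
  then have "P = Q" by blast
  then show "w = v" using P Q by simp
qed

text \<open>Membership is tested on homogeneous components, and a form vanishing at one
  representative vanishes at the whole point.\<close>

lemma vanishing_ideal_coord_vector:
  assumes "XX \<subseteq> projective_space" "finite XX"
  shows "vanishing_ideal XX = point_set.vanish (coord_vector ` XX)"
proof -
  interpret point_set "coord_vector ` XX" using assms by (rule point_set_coord_vector)
  have "(\<forall>v\<in>P. line_eval v f = 0) \<longleftrightarrow> line_eval (coord_vector P) f = 0" if "P \<in> XX" for P f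
  proof -
    have P: "P \<in> projective_space" using assms(1) that by blast
    have "line_eval v f = 0 \<longleftrightarrow> (\<forall>n. eval_mpoly (hom_component n f) v = 0)" for v
      by (simp add: poly_eq_iff eval_hom_component)
    then show ?thesis
      using vanishes_at_coord_vector[OF P homogeneous_hom_component] unfolding vanishes_at_def by blast
  qed
  then show ?thesis unfolding vanishing_ideal_eq vanish_def by auto
qed

theorem corollary4p2:
  fixes XX :: "('k::field ^ 'n::finite) set set"
    and lt :: "'n monomial \<Rightarrow> 'n monomial \<Rightarrow> bool"
    and \<alpha> :: "nat \<Rightarrow> 'n monomial"
    and \<delta> :: "nat \<Rightarrow> nat"
    and s d k l :: nat
    and f :: "('n, 'k) mpoly"
  assumes "s = CARD('n)" and "s \<ge> 2"
    and "XX \<subseteq> projective_space" and "finite XX" and "XX \<noteq> {}"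
    and "graded_monomial_order lt"
    and "complete_intersection \<S> (initial_ideal lt (vanishing_ideal XX))"
    and "initial_ideal lt (vanishing_ideal XX) =
           Idl\<^bsub>\<S>\<^esub> {power_product (\<alpha> i) |i. i \<in> {2..s}}"
    and "\<And>i. i \<in> {2..s} \<Longrightarrow> \<delta> i = mdeg (\<alpha> i)"
    and "\<And>i. i \<in> {2..s} \<Longrightarrow> 1 \<le> \<delta> i"
    and "\<And>i. i \<in> {2..<s} \<Longrightarrow> \<delta> i \<le> \<delta> (i + 1)"
    and "d \<ge> 1" and "k \<le> s - 2"
    and "d = (\<Sum>i=2..k+1. (\<delta> i - 1)) + l"
    and "1 \<le> l" and "l \<le> \<delta> (k + 2) - 1"
    and "homogeneous d f"
    and "\<not> (\<forall>P\<in>XX. vanishes_at f P)"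
  shows "real (card (zeros_in XX f)) \<le>
           quotient_degree (vanishing_ideal XX)
           - real ((\<delta> (k + 2) - l) * (\<Prod>i=k+3..s. \<delta> i))"
proof -
  let ?R = "coord_vector ` XX"
  let ?Z = "{v \<in> ?R. eval_mpoly f v \<noteq> 0}"
  have van: "vanishing_ideal XX = point_set.vanish ?R"
    using assms(3,4) by (rule vanishing_ideal_coord_vector)
  interpret point_set ?R using assms(3,4) by (rule point_set_coord_vector)
  have gens: "{power_product (\<alpha> i) |i. i \<in> {2..s}} = {power_product a |a. a \<in> \<alpha> ` {2..s}}"
    by blast
  interpret initial_monomials ?R lt "\<alpha> ` {2..s}"
    using assms(6,8) unfolding graded_monomial_order_def van gens by unfold_locales auto
  have zero_iff: "vanishes_at f P \<longleftrightarrow> eval_mpoly f (coord_vector P) = 0" if "P \<in> XX" for P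
    using vanishes_at_coord_vector[OF _ assms(17)] assms(3) that by blast
  have "f \<notin> vanish"
    using assms(18) zero_iff homogeneous_vanish_iff[OF assms(17)] by blast
  note notin = this
  have ge: "(\<delta> (k + 2) - l) * (\<Prod>i=k+3..s. \<delta> i) \<le> card ?Z"
    by (rule card_nonzero_ge[OF assms(1,2) refl assms(9,10,11,13,14,16,17) notin])
  have inj: "inj_on coord_vector XX" using inj_on_coord_vector assms(3) by (rule inj_on_subset)
  \<comment> \<open>The zeros are the complement of \<open>?Z\<close> and \<open>card ?R\<close> is
    the degree, so the lower bound for \<open>?Z\<close> becomes the claimed upper bound.\<close>
  have "coord_vector ` zeros_in XX f = ?R - ?Z"
    unfolding zeros_in_def using zero_iff by auto
  moreover have "card (coord_vector ` zeros_in XX f) = card (zeros_in XX f)"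
    by (rule card_image, rule inj_on_subset[OF inj]) (auto simp: zeros_in_def)
  moreover have "card (?R - ?Z) = card ?R - card ?Z" "card ?Z \<le> card ?R"
    using finite by (auto intro!: card_Diff_subset card_mono)
  ultimately have "real (card (zeros_in XX f)) = real (card ?R) - real (card ?Z)" by simp
  moreover have "quotient_degree (vanishing_ideal XX) = real (card ?R)"
    unfolding van using quotient_degree_vanish assms(5) by simp
  ultimately show ?thesis using ge by linarith
qed

end
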